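(* For every partition $\lambda$, there exists a coloring $\kappa$ of the partition graph $G_\lambda$ such that the first $4$ parts of $\operatorname{shape}(\kappa)$ coincide with the first $4$ terms $\delta_1,\delta_2,\delta_3,\delta_4$ of the chromatic difference sequence of $G_\lambda$ (where both sequences are padded with trailing zeros if they have fewer than $4$ terms).
   Context: A partition $\lambda$ is a weakly decreasing finite sequence of positive integers; its (Young) diagram is the left-justified grid of boxes whose rows, from top to bottom, have $\lambda_1,\lambda_2,\dots$ boxes. The partition graph $G_\lambda$ is the graph whose vertices are the boxes of the diagram of $\lambda$, two distinct boxes being adjacent if and only if they lie in the same row or the same column. A coloring of a graph $G$ with vertex set $V$ is a map $\kappa: V\to\mathbb{N}$ with $\kappa(u)\neq\kappa(v)$ whenever $u,v$ are adjacent. Then $\operatorname{shape}(\kappa)$ is the sequence of cardinalities of the color classes (nonempty fibers) of $\kappa$, arranged in weakly decreasing order. A stable set is a set of pairwise non-adjacent vertices. For $i\ge 0$, $\alpha_i(G)$ is the maximum cardinality of a union of $i$ disjoint (possibly empty) stable sets of $G$, and the chromatic difference sequence (CDS) of $G$ is $(\delta_1,\delta_2,\dots)$ with $\delta_i:=\alpha_i(G)-\alpha_{i-1}(G)$ for $i\ge 1$. *)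

theory Defs
  imports
    "HOL-Library.Multiset"
    "HOL-Library.Disjoint_Sets"
    "HOL-Library.More_List"
    "Graph_Theory.Pair_Digraph"
begin

definition is_partition :: "nat list \<Rightarrow> bool" where
  "is_partition lam \<longleftrightarrow> sorted_wrt (\<ge>) lam \<and> (\<forall>k\<in>set lam. 0 < k)"

text \<open>Boxes are pairs (row, column), both numbered from 0.\<close>

definition young_diagram :: "nat list \<Rightarrow> (nat \<times> nat) set" where
  "young_diagram lam = {(i, j). i < length lam \<and> j < lam ! i}"

text \<open>
  As usual in \<^theory>\<open>Graph_Theory.Pair_Digraph\<close>, an undirected simple graph is a symmetric
  loop-free digraph without multiple arcs (\<^locale>\<open>pair_graph\<close>): an edge is a pair of
  opposite arcs.
\<close>

definition partition_graph :: "nat list \<Rightarrow> (nat \<times> nat) pair_pre_digraph" where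
  "partition_graph lam =
    \<lparr> pverts = young_diagram lam,
      parcs = {(u, v). u \<in> young_diagram lam \<and> v \<in> young_diagram lam \<and> u \<noteq> v \<and>
                       (fst u = fst v \<or> snd u = snd v)} \<rparr>"

lemma finite_young_diagram: "finite (young_diagram lam)"
proof -
  have "young_diagram lam = Sigma {..<length lam} (\<lambda>i. {..<lam ! i})"
    by (auto simp: young_diagram_def)
  then show ?thesis by simp
qed

lemma pair_graph_partition_graph: "pair_graph (partition_graph lam)"
proof unfold_locales
  show "finite (pverts (partition_graph lam))"
    by (simp add: partition_graph_def finite_young_diagram)
  show "finite (parcs (partition_graph lam))"
    by (rule finite_subset[of _ "young_diagram lam \<times> young_diagram lam"])
       (auto simp: partition_graph_def finite_young_diagram)
  show "symmetric (with_proj (partition_graph lam))"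
    unfolding symmetric_def by (auto simp: sym_def partition_graph_def)
qed (auto simp: partition_graph_def)

definition coloring :: "'a pair_pre_digraph \<Rightarrow> ('a \<Rightarrow> nat) \<Rightarrow> bool" where
  "coloring G \<kappa> \<longleftrightarrow> (\<forall>(u, v)\<in>parcs G. \<kappa> u \<noteq> \<kappa> v)"

text \<open>
  A coloring is a total function on the vertex type; only its values on the vertices matter.
\<close>

definition color_class :: "'a pair_pre_digraph \<Rightarrow> ('a \<Rightarrow> nat) \<Rightarrow> nat \<Rightarrow> 'a set" where
  "color_class G \<kappa> c = {v \<in> pverts G. \<kappa> v = c}"

definition shape :: "'a pair_pre_digraph \<Rightarrow> ('a \<Rightarrow> nat) \<Rightarrow> nat list" where
  "shape G \<kappa> = rev (sorted_list_of_multiset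
     {# card (color_class G \<kappa> c). c \<in># mset_set (\<kappa> ` pverts G) #})"

definition stable_set :: "'a pair_pre_digraph \<Rightarrow> 'a set \<Rightarrow> bool" where
  "stable_set G S \<longleftrightarrow> S \<subseteq> pverts G \<and> (\<forall>u\<in>S. \<forall>v\<in>S. (u, v) \<notin> parcs G)"

definition max_stable_union :: "'a pair_pre_digraph \<Rightarrow> nat \<Rightarrow> nat" where
  "max_stable_union G i =
    Max {card (\<Union>j<i. S j) |S. (\<forall>j<i. stable_set G (S j)) \<and> disjoint_family_on S {..<i}}"

text \<open>
  The subtraction on natural numbers does not truncate for finite graphs, see the lemma
  \<open>max_stable_union_mono\<close> below. The terms of the sequence are numbered from 1.
\<close>

definition cds :: "'a pair_pre_digraph \<Rightarrow> nat \<Rightarrow> nat" where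
  "cds G i = max_stable_union G i - max_stable_union G (i - 1)"

lemma max_stable_union_mono:
  assumes "finite (pverts G)"
  shows "max_stable_union G i \<le> max_stable_union G (Suc i)"
proof -
  define A where "A i = {card (\<Union>j<i. S j) |S.
    (\<forall>j<i. stable_set G (S j)) \<and> disjoint_family_on S {..<i}}" for i :: nat
  have fin: "finite (A i)" for i
  proof (rule finite_subset)
    show "A i \<subseteq> {..card (pverts G)}"
      unfolding A_def stable_set_def
      by (auto intro!: card_mono[OF assms])
  qed simp
  have ne: "A i \<noteq> {}" for i
  proof -
    have "card (\<Union>j<i. {} :: 'a set) \<in> A i"
      unfolding A_def
      by (rule CollectI, rule exI[of _ "\<lambda>_. {}"]) (auto simp: stable_set_def disjoint_family_on_def)
    then show ?thesis by blast
  qed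
  have "A i \<subseteq> A (Suc i)"
  proof
    fix n assume "n \<in> A i"
    then obtain S where n: "n = card (\<Union>j<i. S j)"
      and st: "\<forall>j<i. stable_set G (S j)" and dj: "disjoint_family_on S {..<i}"
      unfolding A_def by blast
    define T where "T = S(i := {})"
    have "(\<Union>j<Suc i. T j) = (\<Union>j<i. S j)"
      by (auto simp: T_def less_Suc_eq split: if_splits)
    moreover have "\<forall>j<Suc i. stable_set G (T j)"
      using st by (auto simp: T_def less_Suc_eq stable_set_def)
    moreover have "disjoint_family_on T {..<Suc i}"
      using dj unfolding disjoint_family_on_def T_def lessThan_Suc by simp
    ultimately show "n \<in> A (Suc i)"
      unfolding A_def n by (intro CollectI exI[of _ T]) simp
  qed
  then have "Max (A i) \<le> Max (A (Suc i))"
    by (rule Max_mono[OF _ ne fin])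
  then show ?thesis
    by (simp add: max_stable_union_def A_def)
qed

end

theory Submission
  imports Defs
begin

text \<open>
  Stable sets of the partition graph are matchings between rows and columns. If \<open>N x y\<close> is the number
  of boxes in rows \<open>\<ge> x\<close> and columns \<open>\<ge> y\<close>, then a union of \<open>k\<close> matchings has at most
  \<open>F k = min (k (x + y) + N x y)\<close> boxes. So it suffices to find four disjoint matchings of sizes
  \<open>F (i + 1) - F i\<close> for \<open>i < 4\<close>: this makes the bound \<open>F k\<close> sharp for \<open>k \<le> 4\<close>, and all other boxes become
  singleton color classes.

  Let \<open>(a, b)\<close> be a minimiser for \<open>k = 4\<close> with \<open>N a b\<close> minimal. The core, consisting of the boxes in
  rows \<open>\<ge> a\<close> and columns \<open>\<ge> b\<close>, then fits into a 3 by 3 square. The numbers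
  \<open>mu i = F (i + 1) - F i - (a + b)\<close> decrease, are at most 3 and add up to the size of the core. Let \<open>j\<close>
  be the number of those that are at least \<open>mu 0 - 1\<close>; the \<open>l = 4 - j\<close> others are at most 1. Both groups
  consist of nearly equal numbers, so by the equitable version of Koenig's theorem on edge colouring
  it is enough to find two disjoint sets of boxes with row and column degrees at most \<open>j\<close> and \<open>l\<close>, whose
  sizes are the sums over the two groups.

  Inside the core these sets are written down explicitly. The two arms (rows \<open>< a\<close> and columns \<open>\<ge> b\<close>,
  respectively rows \<open>\<ge> a\<close> and columns \<open>< b\<close>) have no row and no column in common, so they can be
  treated separately. In the first one every row has to receive \<open>j\<close> boxes of the first set and \<open>l\<close> of the
  second, subject to the column capacities left over by the core. The rows are filled one by one,
  starting with the narrowest; the first set is chosen greedily, and a single exchange makes room for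
  the second one if necessary. The inequalities \<open>F k \<le> k (x + y) + N x y\<close> guarantee that this never
  fails.
\<close>

section \<open>Equitable edge colouring of bipartite graphs\<close>

definition is_involution_on :: "'a set \<Rightarrow> ('a \<Rightarrow> 'a) \<Rightarrow> bool" where
  "is_involution_on E f \<longleftrightarrow> (\<forall>e\<in>E. f e \<in> E \<and> f e \<noteq> e \<and> f (f e) = e)"

text \<open>Fibres of two elements are matched up; the elements left over are even in number and can
  be paired arbitrarily. The induction strips off two elements with the same key as long as there
  are any, and any two elements once \<open>k\<close> is injective.\<close>

lemma ex_pairing_involution:
  fixes k :: "'a \<Rightarrow> 'b"
  assumes "finite E" "even (card E)" "\<And>i. card {e\<in>E. k e = i} \<le> 2"
  shows "\<exists>f. is_involution_on E f \<and> (\<forall>e\<in>E. \<forall>e'\<in>E. e \<noteq> e' \<longrightarrow> k e = k e' \<longrightarrow> f e = e')"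
  using assms
proof (induction "card E" arbitrary: E rule: less_induct)
  case less
  show ?case
  proof (cases "E = {}")
    case True
    then show ?thesis by (auto simp: is_involution_on_def)
  next
    case False
    have "\<exists>x\<in>E. \<exists>y\<in>E. x \<noteq> y \<and> (k x = k y \<or> inj_on k E)"
    proof (cases "inj_on k E")
      case True
      have "card E \<noteq> 0" "card E \<noteq> 1"
        using False less.prems by auto
      then have "\<not> is_singleton E" "E \<noteq> {}"
        by (auto simp: is_singleton_altdef)
      then show ?thesis using True by (metis is_singletonI' )
    next
      case False
      then show ?thesis by (auto simp: inj_on_def)
    qed
    then obtain x y where xy: "x \<in> E" "y \<in> E" "x \<noteq> y" "k x = k y \<or> inj_on k E" by blast
    have only: "e' \<in> {x, y}" if e': "e' \<in> E" "k e' = k x \<or> k e' = k y" for e'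
    proof (rule ccontr)
      assume n: "e' \<notin> {x, y}"
      then have "k x = k y" using xy e' by (auto simp: inj_on_def)
      then have "{x, y, e'} \<subseteq> {e\<in>E. k e = k x}" using xy e' by auto
      then have "card {x, y, e'} \<le> card {e\<in>E. k e = k x}"
        using less.prems(1) by (intro card_mono) auto
      moreover have "card {x, y, e'} = 3" using n xy by auto
      ultimately show False using less.prems(3)[of "k x"] by simp
    qed
    define E' where "E' = E - {x, y}"
    have c: "card E = card E' + 2"
    proof -
      have "E = insert x (insert y E')" "x \<notin> insert y E'" "y \<notin> E'" "finite E'"
        using xy less.prems(1) by (auto simp: E'_def)
      then show ?thesis by (metis card_insert_disjoint finite_insert add_2_eq_Suc')
    qed
    have "card {e\<in>E'. k e = i} \<le> 2" for i
    proof -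
      have "card {e\<in>E'. k e = i} \<le> card {e\<in>E. k e = i}"
        using less.prems(1) by (intro card_mono) (auto simp: E'_def)
      then show ?thesis using less.prems(3)[of i] by simp
    qed
    then obtain f where f: "is_involution_on E' f"
      "\<forall>e\<in>E'. \<forall>e'\<in>E'. e \<noteq> e' \<longrightarrow> k e = k e' \<longrightarrow> f e = e'"
      using less.hyps[of E'] c less.prems by (auto simp: E'_def)
    have "is_involution_on E (f(x := y, y := x))"
      using f(1) xy unfolding is_involution_on_def E'_def by auto
    moreover have "(f(x := y, y := x)) e = e'"
      if "e \<in> E" "e' \<in> E" "e \<noteq> e'" "k e = k e'" for e e'
    proof (cases "e \<in> {x, y} \<or> e' \<in> {x, y}")
      case True
      then have "e \<in> {x, y} \<and> e' \<in> {x, y}" using only[of e] only[of e'] that by auto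
      then show ?thesis using that xy by auto
    next
      case False
      then show ?thesis using f(2) that by (auto simp: E'_def)
    qed
    ultimately show ?thesis by blast
  qed
qed

text \<open>Joining every \<open>x\<close> to \<open>f x\<close> and to \<open>g x\<close> yields a
  union of even cycles, along which colours alternate. Instead of walking along a cycle, the
  induction deletes the pair \<open>x\<close>, \<open>f x\<close> and closes the gap.\<close>

lemma ex_alternating_coloring:
  assumes "finite X" "is_involution_on X f" "is_involution_on X g"
  shows "\<exists>\<chi> :: 'a \<Rightarrow> bool. \<forall>x\<in>X. \<chi> (f x) = (\<not> \<chi> x) \<and> \<chi> (g x) = (\<not> \<chi> x)"
  using assms
proof (induction "card X" arbitrary: X g rule: less_induct)
  case less
  show ?case
  proof (cases "X = {}")
    case False
    then obtain x where x: "x \<in> X" by blast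
    define y where "y = f x"
    define X' where "X' = X - {x, y}"
    have f: "\<And>z. z \<in> X \<Longrightarrow> f z \<in> X \<and> f z \<noteq> z \<and> f (f z) = z"
      and g: "\<And>z. z \<in> X \<Longrightarrow> g z \<in> X \<and> g z \<noteq> z \<and> g (g z) = z"
      using less.prems by (auto simp: is_involution_on_def)
    have y: "y \<in> X" "y \<noteq> x" "f y = x" "f x = y" using f[OF x] by (auto simp: y_def)
    have card: "card X' < card X"
      using x less.prems(1) by (auto simp: X'_def intro!: psubset_card_mono)
    have f': "is_involution_on X' f"
      unfolding is_involution_on_def
    proof
      fix z assume z: "z \<in> X'"
      then have "f z \<noteq> x" "f z \<noteq> y" using f[of z] y by (auto simp: X'_def)
      then show "f z \<in> X' \<and> f z \<noteq> z \<and> f (f z) = z" using f[of z] z by (auto simp: X'_def)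
    qed
    show ?thesis
    proof (cases "g x = y")
      case True
      have gy: "g y = x" using g[OF x] True by auto
      have "is_involution_on X' g"
        unfolding is_involution_on_def
      proof
        fix z assume z: "z \<in> X'"
        then have "g z \<noteq> x" "g z \<noteq> y" using g[of z] True gy by (auto simp: X'_def)
        then show "g z \<in> X' \<and> g z \<noteq> z \<and> g (g z) = z" using g[of z] z by (auto simp: X'_def)
      qed
      then obtain \<chi> where \<chi>: "\<forall>x\<in>X'. \<chi> (f x) = (\<not> \<chi> x) \<and> \<chi> (g x) = (\<not> \<chi> x)"
        using less.hyps[OF card _ f'] less.prems(1) by (auto simp: X'_def)
      have "\<forall>z\<in>X. (\<chi>(x := True, y := False)) (f z) = (\<not> (\<chi>(x := True, y := False)) z) \<and>
        (\<chi>(x := True, y := False)) (g z) = (\<not> (\<chi>(x := True, y := False)) z)"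
      proof
        fix z assume z: "z \<in> X"
        show "(\<chi>(x := True, y := False)) (f z) = (\<not> (\<chi>(x := True, y := False)) z) \<and>
          (\<chi>(x := True, y := False)) (g z) = (\<not> (\<chi>(x := True, y := False)) z)"
        proof (cases "z = x \<or> z = y")
          case True
          then show ?thesis using y gy \<open>g x = y\<close> by auto
        next
          case False
          then have "f z \<noteq> x" "f z \<noteq> y" "g z \<noteq> x" "g z \<noteq> y" "z \<in> X'"
            using f[OF z] g[OF z] y gy \<open>g x = y\<close> z by (auto simp: X'_def)
          then show ?thesis using \<chi> False by auto
        qed
      qed
      then show ?thesis by blast
    next
      case False
      define u where "u = g x"
      define v where "v = g y"
      have "g u = x" "g v = y" "g x = u" "g y = v"
        using g[OF x] g[OF y(1)] by (auto simp: u_def v_def)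
      then have uv: "u \<in> X'" "v \<in> X'" "u \<noteq> v" "g u = x" "g v = y" "g x = u" "g y = v"
        using g[OF x] g[OF y(1)] False y(2) unfolding X'_def by auto
      \<comment> \<open>The \<open>g\<close>-partners of \<open>x\<close> and \<open>y\<close>
        become partners of each other, so the cycle through \<open>u\<close>, \<open>x\<close>,
        \<open>y\<close>, \<open>v\<close> gets shorter by two vertices.\<close>
      define g' where "g' = g(u := v, v := u)"
      have "is_involution_on X' g'"
        unfolding is_involution_on_def
      proof
        fix z assume z: "z \<in> X'"
        show "g' z \<in> X' \<and> g' z \<noteq> z \<and> g' (g' z) = z"
        proof (cases "z = u \<or> z = v")
          case True
          then show ?thesis using uv by (auto simp: g'_def)
        next
          case False
          have zX: "z \<in> X" "z \<noteq> x" "z \<noteq> y" using z by (auto simp: X'_def)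
          have "g z \<noteq> u" "g z \<noteq> v" "g z \<noteq> x" "g z \<noteq> y"
            using g[OF zX(1)] uv False zX by auto
          then show ?thesis using g[OF zX(1)] False by (auto simp: g'_def X'_def)
        qed
      qed
      then obtain \<chi> where \<chi>: "\<forall>x\<in>X'. \<chi> (f x) = (\<not> \<chi> x) \<and> \<chi> (g' x) = (\<not> \<chi> x)"
        using less.hyps[OF card _ f'] less.prems(1) by (auto simp: X'_def)
      have \<chi>uv: "\<chi> v = (\<not> \<chi> u)" using bspec[OF \<chi> uv(1)] uv(3) by (simp add: g'_def)
      define \<chi>' where "\<chi>' = \<chi>(x := \<not> \<chi> u, y := \<not> \<chi> v)"
      have "\<forall>z\<in>X. \<chi>' (f z) = (\<not> \<chi>' z) \<and> \<chi>' (g z) = (\<not> \<chi>' z)"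
      proof
        fix z assume z: "z \<in> X"
        have ne: "u \<noteq> x" "u \<noteq> y" "v \<noteq> x" "v \<noteq> y" using uv by (auto simp: X'_def)
        consider "z = x" | "z = y" | "z = u" | "z = v" | "z \<notin> {x, y, u, v}" by blast
        then show "\<chi>' (f z) = (\<not> \<chi>' z) \<and> \<chi>' (g z) = (\<not> \<chi>' z)"
        proof cases
          case 5
          then have "z \<in> X'" "g' z = g z" using z by (auto simp: X'_def g'_def)
          moreover have "f z \<noteq> x" "f z \<noteq> y" using f[OF z] y 5 by auto
          moreover have "g z \<noteq> x" "g z \<noteq> y" using g[OF z] uv 5 by auto
          ultimately show ?thesis using bspec[OF \<chi> \<open>z \<in> X'\<close>] 5 by (simp add: \<chi>'_def)
        next
          case 3
          have "f u \<noteq> x" "f u \<noteq> y" using f[OF z] y ne 3 by auto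
          then show ?thesis using bspec[OF \<chi> uv(1)] uv(4,5) y(2) ne 3 \<chi>uv by (simp add: \<chi>'_def)
        next
          case 4
          have "f v \<noteq> x" "f v \<noteq> y" using f[OF z] y ne 4 by auto
          then show ?thesis using bspec[OF \<chi> uv(2)] uv(4,5) y(2) ne 4 \<chi>uv by (simp add: \<chi>'_def)
        next
          case 1
          then show ?thesis using y(2,4) uv(6) ne \<chi>uv by (simp add: \<chi>'_def)
        next
          case 2
          then show ?thesis using y(2,3) uv(7) ne \<chi>uv by (simp add: \<chi>'_def)
        qed
      qed
      then show ?thesis by blast
    qed
  qed auto
qed

section \<open>Splitting bipartite graphs of maximum degree two\<close>

definition matching :: "('a \<times> 'b) set \<Rightarrow> bool" where
  "matching M \<longleftrightarrow> inj_on fst M \<and> inj_on snd M"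

definition max_degree_le :: "('a \<times> 'b) set \<Rightarrow> nat \<Rightarrow> bool" where
  "max_degree_le E k \<longleftrightarrow>
    (\<forall>i. card {e\<in>E. fst e = i} \<le> k) \<and> (\<forall>i. card {e\<in>E. snd e = i} \<le> k)"

text \<open>Edges sharing a row are paired by \<open>f\<close>, edges sharing a column by
  \<open>g\<close>, and an alternating colouring separates the pairs of both kinds. As
  \<open>f\<close> exchanges the two colours, the halves have equal size.\<close>

lemma split_even:
  assumes "finite E" "even (card E)" "max_degree_le E 2"
  shows "\<exists>M N. M \<union> N = E \<and> M \<inter> N = {} \<and> matching M \<and> matching N \<and> card M = card N"
proof -
  obtain f where f: "is_involution_on E f"
    "\<And>e e'. e \<in> E \<Longrightarrow> e' \<in> E \<Longrightarrow> e \<noteq> e' \<Longrightarrow> fst e = fst e' \<Longrightarrow> f e = e'"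
    using ex_pairing_involution[OF assms(1,2), of fst] assms(3)
    unfolding max_degree_le_def by blast
  obtain g where g: "is_involution_on E g"
    "\<And>e e'. e \<in> E \<Longrightarrow> e' \<in> E \<Longrightarrow> e \<noteq> e' \<Longrightarrow> snd e = snd e' \<Longrightarrow> g e = e'"
    using ex_pairing_involution[OF assms(1,2), of snd] assms(3)
    unfolding max_degree_le_def by blast
  obtain \<chi> where \<chi>: "\<And>x. x \<in> E \<Longrightarrow> \<chi> (f x) = (\<not> \<chi> x)" "\<And>x. x \<in> E \<Longrightarrow> \<chi> (g x) = (\<not> \<chi> x)"
    using ex_alternating_coloring[OF assms(1) f(1) g(1)] by blast
  define M where "M = {e\<in>E. \<chi> e}"
  define N where "N = {e\<in>E. \<not> \<chi> e}"
  have "inj_on fst M" "inj_on fst N"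
    using f(2) \<chi>(1) unfolding inj_on_def M_def N_def by blast+
  moreover have "inj_on snd M" "inj_on snd N"
    using g(2) \<chi>(2) unfolding inj_on_def M_def N_def by blast+
  moreover have "bij_betw f M N"
  proof (rule bij_betw_byWitness[where f' = f])
    show "\<forall>a\<in>M. f (f a) = a" "\<forall>a\<in>N. f (f a) = a" "f ` M \<subseteq> N" "f ` N \<subseteq> M"
      using f(1) \<chi>(1) by (auto simp: M_def N_def is_involution_on_def)
  qed
  then have "card M = card N" by (rule bij_betw_same_card)
  ultimately show ?thesis
    by (intro exI[of _ M] exI[of _ N]) (auto simp: matching_def M_def N_def)
qed

lemma max_degree_le_mono:
  assumes "max_degree_le E k" "E' \<subseteq> E" "finite E" "k \<le> k'"
  shows "max_degree_le E' k'"
proof -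
  have "card {e\<in>E'. P e} \<le> card {e\<in>E. P e}" for P
    using assms(2,3) by (intro card_mono) auto
  then show ?thesis
    using assms(1,4) unfolding max_degree_le_def by (meson order_trans)
qed

lemma matching_subset: "matching M \<Longrightarrow> M' \<subseteq> M \<Longrightarrow> matching M'"
  unfolding matching_def by (meson inj_on_subset)

text \<open>Applied to the union of two colour classes, with one more edge or none, this takes the
  place of exchanges along alternating paths.\<close>

lemma split_balanced:
  fixes E :: "(nat \<times> nat) set"
  assumes fin: "finite E" and deg: "max_degree_le E 2"
    and n: "n + n' = card E" "n \<le> n' + 1" "n' \<le> n + 1"
  shows "\<exists>M N. M \<union> N = E \<and> M \<inter> N = {} \<and> matching M \<and> matching N \<and> card M = n \<and> card N = n'"
proof (cases "even (card E)")
  case True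
  then obtain M N where MN: "M \<union> N = E" "M \<inter> N = {}" "matching M" "matching N" "card M = card N"
    using split_even[OF fin True deg] by metis
  then have "card M + card N = card E"
    using fin card_Un_disjoint[of M N] by (metis finite_Un)
  then have "card M = n \<and> card N = n'" using n MN(5) True by presburger
  then show ?thesis using MN by blast
next
  case False
  \<comment> \<open>A dummy edge on two fresh vertices reduces the odd case to the even one.\<close>
  obtain r where r: "r \<notin> fst ` E" using fin ex_new_if_finite infinite_UNIV_nat by blast
  obtain c where c: "c \<notin> snd ` E" using fin ex_new_if_finite infinite_UNIV_nat by blast
  define E' where "E' = insert (r, c) E"
  have new: "(r, c) \<notin> E" using r by force
  have "max_degree_le E' 2"
    unfolding max_degree_le_def
  proof (intro conjI allI)
    fix i
    show "card {e\<in>E'. fst e = i} \<le> 2"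
    proof (cases "i = r")
      case True
      then have "{e\<in>E'. fst e = i} = {(r, c)}" using r by (force simp: E'_def)
      then show ?thesis by simp
    next
      case False
      then have "{e\<in>E'. fst e = i} = {e\<in>E. fst e = i}" by (auto simp: E'_def)
      then show ?thesis using deg by (simp add: max_degree_le_def)
    qed
    show "card {e\<in>E'. snd e = i} \<le> 2"
    proof (cases "i = c")
      case True
      then have "{e\<in>E'. snd e = i} = {(r, c)}" using c by (force simp: E'_def)
      then show ?thesis by simp
    next
      case False
      then have "{e\<in>E'. snd e = i} = {e\<in>E. snd e = i}" by (auto simp: E'_def)
      then show ?thesis using deg by (simp add: max_degree_le_def)
    qed
  qed
  moreover have fin': "finite E'" and c': "card E' = card E + 1"
    using fin new by (auto simp: E'_def)
  ultimately obtain M N where MN: "M \<union> N = E'" "M \<inter> N = {}" "matching M" "matching N"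
    "card M = card N"
    using split_even[of E'] False by auto
  have "\<exists>M N. M \<union> N = E' \<and> M \<inter> N = {} \<and> matching M \<and> matching N \<and> card M = card N \<and> (r, c) \<in> M"
  proof (cases "(r, c) \<in> M")
    case False
    then have "(r, c) \<in> N" using MN by (auto simp: E'_def)
    then show ?thesis using MN by (intro exI[of _ N] exI[of _ M]) auto
  qed (use MN in blast)
  then obtain M N where MN: "M \<union> N = E'" "M \<inter> N = {}" "matching M" "matching N"
    "card M = card N" "(r, c) \<in> M" by blast
  have fMN: "finite M" "finite N" using MN(1) fin' by auto
  have "card M + card N = card E'"
    using fMN MN(1,2) card_Un_disjoint[of M N] by simp
  moreover have "card (M - {(r, c)}) = card M - 1" "card M > 0"
    using MN(6) fMN by (auto simp: card_gt_0_iff)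
  ultimately have cards: "card (M - {(r, c)}) + 1 = card N" "2 * card N = card E + 1"
    using MN(5) c' by auto
  have un: "(M - {(r, c)}) \<union> N = E" "(M - {(r, c)}) \<inter> N = {}"
    using MN new by (auto simp: E'_def)
  have mt: "matching (M - {(r, c)})" using MN(3) matching_subset by blast
  show ?thesis
  proof (cases "n \<le> n'")
    case True
    then have "card (M - {(r, c)}) = n" "card N = n'" using cards n False by presburger+
    then show ?thesis using un mt MN(4) by blast
  next
    case nle: False
    then have "card (M - {(r, c)}) = n'" "card N = n" using cards n False by presburger+
    then show ?thesis using un mt MN(4) by (metis Int_commute Un_commute)
  qed
qed

section \<open>Proper edge colourings and their class sizes\<close>

definition proper_edge_coloring :: "nat \<Rightarrow> (nat \<Rightarrow> (nat \<times> nat) set) \<Rightarrow> bool" where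
  "proper_edge_coloring k M \<longleftrightarrow> (\<forall>i<k. matching (M i)) \<and> disjoint_family_on M {..<k}"

text \<open>\<open>F\<close> is a single new edge when a colouring is extended, and empty when two
  classes are rebalanced.\<close>

lemma recolor_two_classes:
  assumes M: "proper_edge_coloring k M" and ab: "\<alpha> < k" "\<beta> < k" "\<alpha> \<noteq> \<beta>"
    and AB: "matching A" "matching B" "A \<inter> B = {}"
    and un: "A \<union> B = F \<union> M \<alpha> \<union> M \<beta>" and F: "F \<inter> (\<Union>i<k. M i) = {}"
  shows "proper_edge_coloring k (M(\<alpha> := A, \<beta> := B))"
    and "(\<Union>i<k. (M(\<alpha> := A, \<beta> := B)) i) = F \<union> (\<Union>i<k. M i)"
proof -
  have disj: "M i \<inter> M j = {}" if "i < k" "j < k" "i \<noteq> j" for i j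
    using M that by (auto simp: proper_edge_coloring_def disjoint_family_on_def)
  have other: "(A \<union> B) \<inter> M i = {}" if "i < k" "i \<noteq> \<alpha>" "i \<noteq> \<beta>" for i
    using disj[of i \<alpha>] disj[of i \<beta>] that ab F unfolding un by blast
  have "(M(\<alpha> := A, \<beta> := B)) i \<inter> (M(\<alpha> := A, \<beta> := B)) j = {}"
    if "i < k" "j < k" "i \<noteq> j" for i j
    using that AB(3) other[of i] other[of j] disj[of i j] by auto
  moreover have "matching ((M(\<alpha> := A, \<beta> := B)) i)" if "i < k" for i
    using that AB M by (auto simp: proper_edge_coloring_def)
  ultimately show "proper_edge_coloring k (M(\<alpha> := A, \<beta> := B))"
    unfolding proper_edge_coloring_def disjoint_family_on_def by simp
  have "(\<Union>i<k. (M(\<alpha> := A, \<beta> := B)) i) = (A \<union> B) \<union> (\<Union>i\<in>{..<k} - {\<alpha>, \<beta>}. M i)"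
    using ab by (auto split: if_splits)
  also have "\<dots> = F \<union> (\<Union>i<k. M i)" unfolding un using ab by blast
  finally show "(\<Union>i<k. (M(\<alpha> := A, \<beta> := B)) i) = F \<union> (\<Union>i<k. M i)" .
qed

lemma card_key_matching:
  assumes "inj_on f M"
  shows "card {e\<in>M. f e = i} \<le> 1"
proof -
  have "is_singleton {e\<in>M. f e = i} \<or> {e\<in>M. f e = i} = {}"
    using assms by (auto simp: inj_on_def intro!: is_singletonI')
  then show ?thesis by (elim disjE) (simp_all add: is_singleton_altdef del: Collect_empty_eq)
qed

lemma card_key_Un:
  assumes "finite A" "finite B"
  shows "card {e\<in>A \<union> B. f e = i} \<le> card {e\<in>A. f e = i} + card {e\<in>B. f e = i}"
proof -
  have "{e\<in>A \<union> B. f e = i} = {e\<in>A. f e = i} \<union> {e\<in>B. f e = i}" by auto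
  then show ?thesis using card_Un_le[of "{e\<in>A. f e = i}" "{e\<in>B. f e = i}"] by (simp only:)
qed

lemma ex_missing_color:
  assumes fin: "finite E" and E: "(\<Union>i<k. M i) = E" and d: "disjoint_family_on M {..<k}"
    and less: "card {e\<in>E. f e = u} < k"
  shows "\<exists>\<alpha><k. u \<notin> f ` M \<alpha>"
proof (rule ccontr)
  assume "\<not> ?thesis"
  then have "\<forall>\<alpha>\<in>{..<k}. \<exists>e. e \<in> M \<alpha> \<and> f e = u" by auto
  then obtain g where g: "\<forall>\<alpha>\<in>{..<k}. g \<alpha> \<in> M \<alpha> \<and> f (g \<alpha>) = u" by metis
  have "inj_on g {..<k}"
  proof (rule inj_onI)
    fix x y assume "x \<in> {..<k}" "y \<in> {..<k}" "g x = g y"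
    then show "x = y" using g d unfolding disjoint_family_on_def by (metis IntI emptyE)
  qed
  then have "k = card (g ` {..<k})" by (simp add: card_image)
  also have "\<dots> \<le> card {e\<in>E. f e = u}"
    using g E fin by (intro card_mono) auto
  finally show False using less by simp
qed

text \<open>Edges are inserted one at a time. If \<open>\<alpha>\<close> is missing at the row of
  the new edge and \<open>\<beta>\<close> at its column, then these two classes together with the
  edge have degrees at most 2 and can be split afresh.\<close>

lemma Koenig_edge_coloring:
  fixes E :: "(nat \<times> nat) set"
  assumes "finite E" "max_degree_le E k"
  shows "\<exists>M. proper_edge_coloring k M \<and> (\<Union>i<k. M i) = E"
  using assms
proof (induction E rule: finite_induct)
  case empty
  then show ?case
    by (intro exI[of _ "\<lambda>_. {}"])
      (auto simp: proper_edge_coloring_def matching_def disjoint_family_on_def)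
next
  case (insert e E)
  have "max_degree_le E k"
    using max_degree_le_mono[OF insert.prems _ _ order_refl] insert.hyps by blast
  then obtain M where M: "proper_edge_coloring k M" "(\<Union>i<k. M i) = E"
    using insert.IH by blast
  have dM: "disjoint_family_on M {..<k}" using M by (simp add: proper_edge_coloring_def)
  have fM: "finite (M i)" if "i < k" for i
    using M(2) insert.hyps(1) that by (auto intro: finite_subset)
  have less: "card {e'\<in>E. f e' = f e} < k" if "card {e'\<in>insert e E. f e' = f e} \<le> k"
    for f :: "nat \<times> nat \<Rightarrow> nat"
  proof -
    have "{e'\<in>insert e E. f e' = f e} = insert e {e'\<in>E. f e' = f e}" by auto
    then show ?thesis using that insert.hyps by simp
  qed
  obtain \<alpha> where \<alpha>: "\<alpha> < k" "fst e \<notin> fst ` M \<alpha>"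
    using ex_missing_color[OF insert.hyps(1) M(2) dM less[of fst]] insert.prems
    by (auto simp: max_degree_le_def)
  obtain \<beta> where \<beta>: "\<beta> < k" "snd e \<notin> snd ` M \<beta>"
    using ex_missing_color[OF insert.hyps(1) M(2) dM less[of snd]] insert.prems
    by (auto simp: max_degree_le_def)
  show ?case
  proof (cases "\<alpha> = \<beta>")
    case True
    define M' where "M' = M(\<alpha> := insert e (M \<alpha>))"
    have "e \<notin> M i" if "i < k" for i using M(2) insert.hyps(2) that by auto
    then have "proper_edge_coloring k M'"
      using M(1) \<alpha> \<beta> True unfolding proper_edge_coloring_def disjoint_family_on_def M'_def
      by (auto simp: matching_def)
    moreover have "(\<Union>i<k. M' i) = insert e E"
      using M(2) \<alpha> unfolding M'_def by (auto split: if_splits)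
    ultimately show ?thesis by blast
  next
    case False
    define F where "F = {e} \<union> (M \<alpha> \<union> M \<beta>)"
    have inj: "inj_on fst (M \<alpha>)" "inj_on snd (M \<alpha>)" "inj_on fst (M \<beta>)" "inj_on snd (M \<beta>)"
      using M(1) \<alpha> \<beta> by (auto simp: proper_edge_coloring_def matching_def)
    have key: "card {x\<in>F. f x = i} \<le> 2"
      if inj: "inj_on f (M \<alpha>)" "inj_on f (M \<beta>)" and no: "f e \<notin> f ` M \<alpha> \<or> f e \<notin> f ` M \<beta>"
      for f :: "nat \<times> nat \<Rightarrow> nat" and i
    proof -
      have "card {x\<in>F. f x = i} \<le> card {x\<in>{e}. f x = i} + card {x\<in>M \<alpha> \<union> M \<beta>. f x = i}"
        unfolding F_def using fM \<alpha> \<beta> by (intro card_key_Un) auto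
      also have "\<dots> \<le> card {x\<in>{e}. f x = i} + (card {x\<in>M \<alpha>. f x = i} + card {x\<in>M \<beta>. f x = i})"
        using fM \<alpha> \<beta> by (intro add_left_mono card_key_Un) auto
      also have "\<dots> \<le> 2"
      proof (cases "f e = i")
        case True
        then have z: "{x\<in>M \<alpha>. f x = i} = {} \<or> {x\<in>M \<beta>. f x = i} = {}" using no by (auto simp: image_iff)
        then have "card {x\<in>M \<alpha>. f x = i} = 0 \<or> card {x\<in>M \<beta>. f x = i} = 0"
          by (elim disjE) (simp_all only: card.empty simp_thms)
        moreover have "card {x\<in>{e}. f x = i} \<le> 1" by (rule card_key_matching) simp
        ultimately show ?thesis
          using card_key_matching[OF inj(1), of i] card_key_matching[OF inj(2), of i] by linarith
      next
        case False
        then have "card {x\<in>{e}. f x = i} = 0" by (auto simp: card_eq_0_iff)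
        then show ?thesis
          using card_key_matching[OF inj(1), of i] card_key_matching[OF inj(2), of i] by linarith
      qed
      finally show ?thesis .
    qed
    have deg: "max_degree_le F 2"
      unfolding max_degree_le_def using key[OF inj(1,3)] key[OF inj(2,4)] \<alpha> \<beta> by blast
    have finF: "finite F" using fM \<alpha> \<beta> by (simp add: F_def)
    have "card F - card F div 2 + card F div 2 = card F"
      "card F - card F div 2 \<le> card F div 2 + 1" "card F div 2 \<le> card F - card F div 2 + 1"
      by linarith+
    then obtain A B where AB: "A \<union> B = F" "A \<inter> B = {}" "matching A" "matching B"
      using split_balanced[OF finF deg] by meson
    have un: "A \<union> B = {e} \<union> M \<alpha> \<union> M \<beta>" using AB(1) by (simp add: F_def)
    have new: "{e} \<inter> (\<Union>i<k. M i) = {}" using M(2) insert.hyps by auto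
    show ?thesis
      using recolor_two_classes[OF M(1) \<alpha>(1) \<beta>(1) False AB(3,4,2) un new] M(2) by (metis insert_is_Un)
  qed
qed

lemma card_proper_edge_coloring:
  assumes "proper_edge_coloring k M" "(\<Union>i<k. M i) = E" "finite E"
  shows "(\<Sum>i<k. card (M i)) = card E"
proof -
  have "finite (M i)" if "i < k" for i using assms that by (auto intro: finite_subset)
  then show ?thesis
    using assms card_UN_disjoint'[of M "{..<k}"] by (auto simp: proper_edge_coloring_def)
qed

text \<open>The two deviations from the targets keep their sum, while their difference drops from at
  least 2 to at most 1 in absolute value; hence the sum of their squares decreases.\<close>

lemma ex_balancing_sizes:
  fixes s s' m m' :: nat
  assumes "m \<le> m' + 1" "m' \<le> m + 1" "s > m" "s' < m'"
  shows "\<exists>n n'. n + n' = s + s' \<and> n \<le> n' + 1 \<and> n' \<le> n + 1 \<and>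
    (int n - int m)\<^sup>2 + (int n' - int m')\<^sup>2 < (int s - int m)\<^sup>2 + (int s' - int m')\<^sup>2"
proof -
  define S where "S = s + s'"
  \<comment> \<open>The larger half goes to the larger target, so that \<open>n - n'\<close> and
    \<open>m - m'\<close> lie both in {0, 1} or both in {-1, 0}.\<close>
  define n where "n = (if m \<ge> m' then S - S div 2 else S div 2)"
  define n' where "n' = S - n"
  define u v x y where "u = int n - int m" "v = int n' - int m'" "x = int s - int m" "y = int s' - int m'"
  have n: "n + n' = S" "n \<le> n' + 1" "n' \<le> n + 1" unfolding n_def n'_def by auto
  have uv: "u + v = x + y" using n unfolding u_v_x_y_def S_def by linarith
  have "\<bar>u - v\<bar> \<le> 1"
    using assms n unfolding u_v_x_y_def n_def n'_def by auto
  moreover have "x - y \<ge> 2" using assms unfolding u_v_x_y_def by linarith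
  ultimately have "\<bar>u - v\<bar> < \<bar>x - y\<bar>" by linarith
  then have "(u - v)\<^sup>2 < (x - y)\<^sup>2" by (metis abs_ge_zero power2_abs power_strict_mono zero_less_numeral)
  moreover have "2 * (u\<^sup>2 + v\<^sup>2) = (u + v)\<^sup>2 + (u - v)\<^sup>2" "2 * (x\<^sup>2 + y\<^sup>2) = (x + y)\<^sup>2 + (x - y)\<^sup>2"
    by (simp_all add: power2_eq_square algebra_simps)
  ultimately have "u\<^sup>2 + v\<^sup>2 < x\<^sup>2 + y\<^sup>2" using uv by auto
  then show ?thesis using n unfolding u_v_x_y_def S_def by blast
qed

text \<open>A proper colouring with least squared deviation \<open>\<Phi>\<close> is taken. If a
  class missed its target, some class would be too large and another one too small, and splitting
  their union afresh would lower \<open>\<Phi>\<close>.\<close>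

lemma equitable_edge_coloring:
  fixes E :: "(nat \<times> nat) set"
  assumes fin: "finite E" and deg: "max_degree_le E k"
    and m: "(\<Sum>i<k. m i) = card E" "\<And>i j. i < k \<Longrightarrow> j < k \<Longrightarrow> m i \<le> m j + (1::nat)"
  shows "\<exists>M. proper_edge_coloring k M \<and> (\<Union>i<k. M i) = E \<and> (\<forall>i<k. card (M i) = m i)"
proof -
  define P where "P M \<longleftrightarrow> proper_edge_coloring k M \<and> (\<Union>i<k. M i) = E" for M
  define \<Phi> where "\<Phi> M = (\<Sum>i<k. (int (card (M i)) - int (m i))\<^sup>2)" for M :: "nat \<Rightarrow> (nat \<times> nat) set"
  have nonneg: "\<Phi> M \<ge> 0" for M by (simp add: \<Phi>_def sum_nonneg)
  obtain M where M: "P M" and min: "\<And>M'. P M' \<Longrightarrow> nat (\<Phi> M) \<le> nat (\<Phi> M')"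
    using ex_has_least_nat[of P _ "\<lambda>M. nat (\<Phi> M)"] Koenig_edge_coloring[OF fin deg]
    unfolding P_def by metis
  have fM: "finite (M i)" if "i < k" for i
  proof (rule finite_subset[OF _ fin])
    show "M i \<subseteq> E" using M that unfolding P_def by blast
  qed
  have sum: "(\<Sum>i<k. card (M i)) = (\<Sum>i<k. m i)"
    using M m(1) card_proper_edge_coloring[OF _ _ fin] by (simp add: P_def)
  have "card (M i) = m i" if "i < k" for i
  proof (rule ccontr)
    assume ne: "card (M i) \<noteq> m i"
    have "\<exists>\<alpha><k. card (M \<alpha>) > m \<alpha>"
    proof (rule ccontr)
      assume "\<not> ?thesis"
      then have "\<forall>\<alpha><k. card (M \<alpha>) \<le> m \<alpha>" by (meson not_less)
      then have "(\<Sum>i<k. card (M i)) < (\<Sum>i<k. m i)"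
        using ne that by (intro sum_strict_mono_ex1) (auto simp: order_less_le intro!: bexI[of _ i])
      then show False using sum by simp
    qed
    then obtain \<alpha> where \<alpha>: "\<alpha> < k" "card (M \<alpha>) > m \<alpha>" by blast
    have "\<exists>\<beta><k. card (M \<beta>) < m \<beta>"
    proof (rule ccontr)
      assume "\<not> ?thesis"
      then have "\<forall>\<beta><k. m \<beta> \<le> card (M \<beta>)" by (meson not_less)
      then have "(\<Sum>i<k. m i) < (\<Sum>i<k. card (M i))"
        using ne that by (intro sum_strict_mono_ex1) (auto simp: order_less_le intro!: bexI[of _ i])
      then show False using sum by simp
    qed
    then obtain \<beta> where \<beta>: "\<beta> < k" "card (M \<beta>) < m \<beta>" by blast
    have ab: "\<alpha> \<noteq> \<beta>" using \<alpha> \<beta> by auto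
    obtain n n' where n: "n + n' = card (M \<alpha>) + card (M \<beta>)" "n \<le> n' + 1" "n' \<le> n + 1"
      "(int n - int (m \<alpha>))\<^sup>2 + (int n' - int (m \<beta>))\<^sup>2
        < (int (card (M \<alpha>)) - int (m \<alpha>))\<^sup>2 + (int (card (M \<beta>)) - int (m \<beta>))\<^sup>2"
      using ex_balancing_sizes[OF m(2)[OF \<alpha>(1) \<beta>(1)] m(2)[OF \<beta>(1) \<alpha>(1)] \<alpha>(2) \<beta>(2)] by blast
    define F where "F = M \<alpha> \<union> M \<beta>"
    have inj: "inj_on fst (M \<alpha>)" "inj_on snd (M \<alpha>)" "inj_on fst (M \<beta>)" "inj_on snd (M \<beta>)"
      and disj: "M \<alpha> \<inter> M \<beta> = {}"
      using M \<alpha> \<beta> ab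
      by (auto simp: P_def proper_edge_coloring_def matching_def disjoint_family_on_def)
    have key: "card {x\<in>F. f x = i} \<le> 2" if inj: "inj_on f (M \<alpha>)" "inj_on f (M \<beta>)"
      for f :: "nat \<times> nat \<Rightarrow> nat" and i
    proof -
      have "card {x\<in>F. f x = i} \<le> card {x\<in>M \<alpha>. f x = i} + card {x\<in>M \<beta>. f x = i}"
        unfolding F_def using fM \<alpha> \<beta> by (intro card_key_Un) auto
      then show ?thesis
        using card_key_matching[OF inj(1), of i] card_key_matching[OF inj(2), of i] by simp
    qed
    have degF: "max_degree_le F 2"
      unfolding max_degree_le_def using key[OF inj(1,3)] key[OF inj(2,4)] by blast
    have finF: "finite F" using fM \<alpha> \<beta> by (simp add: F_def)
    have "n + n' = card F" using n(1) fM \<alpha> \<beta> disj by (simp add: F_def card_Un_disjoint)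
    then obtain A B where AB: "A \<union> B = F" "A \<inter> B = {}" "matching A" "matching B"
      "card A = n" "card B = n'"
      using split_balanced[OF finF degF _ n(2,3)] by blast
    define M' where "M' = M(\<alpha> := A, \<beta> := B)"
    have "A \<union> B = {} \<union> M \<alpha> \<union> M \<beta>" using AB by (simp add: F_def)
    then have "P M'"
      using recolor_two_classes[OF _ \<alpha>(1) \<beta>(1) ab AB(3,4,2), of M "{}"] M
      by (auto simp: P_def M'_def)
    have split: "(\<Sum>i<k. h i) = h \<alpha> + (h \<beta> + (\<Sum>i\<in>{..<k} - {\<alpha>} - {\<beta>}. h i))" for h :: "nat \<Rightarrow> int"
      using \<alpha> \<beta> ab by (simp add: sum.remove[of "{..<k}" \<alpha>] sum.remove[of "{..<k} - {\<alpha>}" \<beta>])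
    have "\<Phi> M' < \<Phi> M"
    proof -
      have rest: "(\<Sum>i\<in>{..<k} - {\<alpha>} - {\<beta>}. (int (card (M' i)) - int (m i))\<^sup>2)
        = (\<Sum>i\<in>{..<k} - {\<alpha>} - {\<beta>}. (int (card (M i)) - int (m i))\<^sup>2)"
        by (intro sum.cong) (auto simp: M'_def)
      have "card (M' \<alpha>) = n" "card (M' \<beta>) = n'" using AB ab by (auto simp: M'_def)
      then show ?thesis unfolding \<Phi>_def split rest using n(4) by simp
    qed
    then show False using min[OF \<open>P M'\<close>] nonneg[of M'] by linarith
  qed
  then show ?thesis using M unfolding P_def by blast
qed

section \<open>Filling nested rows by two families of column sets\<close>

definition column_degree :: "nat \<Rightarrow> (nat \<Rightarrow> nat set) \<Rightarrow> nat \<Rightarrow> nat" where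
  "column_degree t K c = (\<Sum>r<t. of_bool (c \<in> K r))"

definition column_height :: "(nat \<Rightarrow> nat) \<Rightarrow> nat \<Rightarrow> nat \<Rightarrow> nat \<Rightarrow> nat" where
  "column_height w t s c = (\<Sum>r\<in>{t..<t + s}. of_bool (c < w r))"

lemma column_height_Suc:
  "column_height w t (Suc s) c = of_bool (c < w t) + column_height w (Suc t) s c"
proof -
  have "{t..<t + Suc s} = insert t {Suc t..<Suc t + s}" by auto
  then show ?thesis unfolding column_height_def by (simp del: sum_of_bool_eq)
qed

lemma column_height_0: "column_height w t 0 c = 0"
  by (simp add: column_height_def)

lemma column_degree_Suc: "column_degree (Suc t) K c = column_degree t K c + of_bool (c \<in> K t)"
  by (simp add: column_degree_def)

lemma column_degree_upd: "t \<le> r \<Longrightarrow> column_degree t (K(r := T)) c = column_degree t K c"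
  unfolding column_degree_def by (intro sum.cong) auto

lemma column_degree_pos: "r < t \<Longrightarrow> c \<in> K r \<Longrightarrow> 0 < column_degree t K c"
  unfolding column_degree_def by (rule sum_pos2[of _ r]) auto

lemma sum_of_bool_mem: "finite A \<Longrightarrow> B \<subseteq> A \<Longrightarrow> (\<Sum>c\<in>A. of_bool (c \<in> B)) = card B"
  by (simp add: of_bool_def sum.If_cases Int_absorb1 Int_absorb2 )

lemma sum_column_degree:
  assumes "\<And>r. r < t \<Longrightarrow> K r \<subseteq> {..<n}"
  shows "(\<Sum>c<n. column_degree t K c) = (\<Sum>r<t. card (K r))"
proof -
  have "(\<Sum>c<n. column_degree t K c) = (\<Sum>r<t. \<Sum>c<n. of_bool (c \<in> K r))"
    unfolding column_degree_def by (rule sum.swap)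
  also have "\<dots> = (\<Sum>r<t. card (K r))"
    using assms by (intro sum.cong refl sum_of_bool_mem) auto
  finally show ?thesis .
qed

lemma ex_top_subset:
  fixes p :: "'a \<Rightarrow> nat"
  assumes "finite X" "j \<le> card X"
  shows "\<exists>S\<subseteq>X. card S = j \<and> (\<forall>x\<in>S. \<forall>y\<in>X - S. p y \<le> p x)"
  using assms(2)
proof (induction j)
  case 0
  show ?case by (rule exI[of _ "{}"]) simp
next
  case (Suc j)
  then obtain S where S: "S \<subseteq> X" "card S = j" "\<forall>x\<in>S. \<forall>y\<in>X - S. p y \<le> p x" by auto
  have fin: "finite S" "finite (X - S)" using S(1) assms(1) finite_subset by auto
  have "X - S \<noteq> {}" using S Suc.prems fin by (metis Diff_eq_empty_iff card_mono not_less_eq_eq)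
  then have "Max (p ` (X - S)) \<in> p ` (X - S)" using fin by simp
  then obtain m where m: "m \<in> X - S" "p m = Max (p ` (X - S))" by auto
  then have "\<forall>y\<in>X - S. p y \<le> p m" using fin by simp
  then show ?case
    using S m fin by (intro exI[of _ "insert m S"]) auto
qed

text \<open>Row \<open>r < a\<close> is the interval \<open>{..<w r}\<close>; column
  \<open>c\<close> may be used \<open>kap c\<close> times by the sets of size \<open>j\<close> and
  \<open>iot c\<close> times by those of size \<open>l\<close>. The two \<open>feasible\<close>
  assumptions are Hall conditions, for the first family alone and for both together. By
  \<open>iot_room\<close>, at least \<open>3 * l\<close> units of \<open>iot\<close> remain within
  row \<open>t\<close> after the \<open>t\<close> rows before it; \<open>tight\<close> concerns the
  case that exactly so many remain.\<close>

locale nested_rows =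
  fixes w :: "nat \<Rightarrow> nat" and a W j l :: nat and kap iot :: "nat \<Rightarrow> nat"
  assumes mono: "\<And>r r'. r \<le> r' \<Longrightarrow> r' < a \<Longrightarrow> w r \<le> w r'"
    and width: "\<And>r. r < a \<Longrightarrow> w r \<le> W"
    and jl: "j + l = 4"
    and iot_le: "\<And>c. iot c \<le> l"
    and feasible_init: "\<And>s. s \<le> a \<Longrightarrow> j * s \<le> (\<Sum>c<W. min (kap c) (column_height w 0 s c))"
    and feasible_both:
      "\<And>s. s \<le> a \<Longrightarrow> 4 * s \<le> (\<Sum>c<W. min (kap c + iot c) (column_height w 0 s c))"
    and iot_room: "\<And>t. t < a \<Longrightarrow> l * (t + 3) \<le> (\<Sum>c<w t. iot c)"
    and tight: "\<And>t. t < a \<Longrightarrow> 0 < l \<Longrightarrow> (\<Sum>c<w t. iot c) = l * (t + 3) \<Longrightarrow>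
      (\<Sum>c<w t. kap c) \<le> j * (t + 2)"
begin

section \<open>Adding one row to a filling\<close>

definition residual :: "nat \<Rightarrow> (nat \<Rightarrow> nat set) \<Rightarrow> nat \<Rightarrow> nat" where
  "residual t J c = kap c - column_degree t J c"

text \<open>As the rows are nested, this is Hall's condition for the rows \<open>\<ge> t\<close>: among all sets of \<open>s\<close>
  rows the \<open>s\<close> narrowest ones give the strongest restriction.\<close>

definition feasible :: "nat \<Rightarrow> (nat \<Rightarrow> nat) \<Rightarrow> bool" where
  "feasible t p \<longleftrightarrow> (\<forall>s. t + s \<le> a \<longrightarrow> j * s \<le> (\<Sum>c<W. min (p c) (column_height w t s c)))"

definition filling :: "nat \<Rightarrow> (nat \<Rightarrow> nat set) \<Rightarrow> (nat \<Rightarrow> nat set) \<Rightarrow> bool" where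
  "filling t J K \<longleftrightarrow>
    (\<forall>r<t. J r \<subseteq> {..<w r} \<and> card (J r) = j \<and> K r \<subseteq> {..<w r} \<and> card (K r) = l \<and> J r \<inter> K r = {}) \<and>
    (\<forall>c. column_degree t J c \<le> kap c) \<and> (\<forall>c. column_degree t K c \<le> iot c)"

text \<open>If a rejected column of row \<open>t\<close> has capacity above \<open>s\<close>, then
  so have all chosen ones, and even after their use these alone supply \<open>j * s\<close>.
  Otherwise row \<open>t\<close> contributes nothing at the rejected columns to the condition for
  \<open>s + 1\<close> rows, and the chosen ones lose at most \<open>j\<close> units.\<close>

lemma feasible_greedy:
  assumes t: "t < a" and feas: "feasible t p"
    and S: "S \<subseteq> {..<w t}" "card S = j" "\<And>x y. x \<in> S \<Longrightarrow> y \<in> {..<w t} - S \<Longrightarrow> p y \<le> p x"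
  shows "feasible (Suc t) (\<lambda>c. p c - of_bool (c \<in> S))"
  unfolding feasible_def
proof (intro allI impI)
  fix s assume s: "Suc t + s \<le> a"
  define h where "h = column_height w (Suc t) s"
  have SW: "S \<subseteq> {..<W}" using S(1) width[OF t] by auto
  have h_low: "h c = s" if "c < w t" for c
  proof -
    have "c < w r" if "r \<in> {Suc t..<Suc t + s}" for r
      using mono[of t r] that s \<open>c < w t\<close> by auto
    then have "h c = (\<Sum>r\<in>{Suc t..<Suc t + s}. 1)"
      unfolding h_def column_height_def by (intro sum.cong) auto
    then show ?thesis by simp
  qed
  have h_Suc: "column_height w t (Suc s) c = of_bool (c < w t) + h c" for c
    unfolding h_def by (rule column_height_Suc)
  show "j * s \<le> (\<Sum>c<W. min (p c - of_bool (c \<in> S)) (column_height w (Suc t) s c))"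
    unfolding h_def[symmetric]
  proof (cases "\<exists>y\<in>{..<w t} - S. s < p y")
    case True
    then have "s < p x" if "x \<in> S" for x using S(3) that by (meson less_le_trans)
    then have "(\<Sum>c\<in>S. s) \<le> (\<Sum>c\<in>S. min (p c - of_bool (c \<in> S)) (h c))"
      using S(1) h_low by (intro sum_mono) fastforce
    also have "\<dots> \<le> (\<Sum>c<W. min (p c - of_bool (c \<in> S)) (h c))"
      using SW by (intro sum_mono2) auto
    finally show "j * s \<le> (\<Sum>c<W. min (p c - of_bool (c \<in> S)) (h c))" using S(2) by simp
  next
    case False
    have "j * Suc s \<le> (\<Sum>c<W. min (p c) (column_height w t (Suc s) c))"
      using feas s unfolding feasible_def by (metis add_Suc_right add_Suc)
    also have "\<dots> \<le> (\<Sum>c<W. min (p c - of_bool (c \<in> S)) (h c) + of_bool (c \<in> S))"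
    proof (intro sum_mono)
      fix c assume "c \<in> {..<W}"
      show "min (p c) (column_height w t (Suc s) c)
        \<le> min (p c - of_bool (c \<in> S)) (h c) + of_bool (c \<in> S)"
      proof (cases "c \<in> S")
        case True
        then show ?thesis using S(1) unfolding h_Suc by auto
      next
        case notS: False
        show ?thesis
        proof (cases "c < w t")
          case True
          then have "c \<in> {..<w t} - S" using notS by simp
          then have "p c \<le> s" using False not_less by blast
          then show ?thesis using True h_low[OF True] by simp
        qed (use notS in \<open>simp add: h_Suc\<close>)
      qed
    qed
    also have "\<dots> = (\<Sum>c<W. min (p c - of_bool (c \<in> S)) (h c)) + j"
      using S(2) SW by (simp add: sum.distrib sum_of_bool_mem Int_absorb1)
    finally show "j * s \<le> (\<Sum>c<W. min (p c - of_bool (c \<in> S)) (h c))" by simp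
  qed
qed

text \<open>If a chosen column had capacity 0, so would all rejected ones, and the other
  \<open>j - 1\<close> chosen columns could not satisfy the condition for a single row.\<close>

lemma feasible_top_pos:
  assumes t: "t < a" and feas: "feasible t p"
    and S: "S \<subseteq> {..<w t}" "card S = j" "\<And>x y. x \<in> S \<Longrightarrow> y \<in> {..<w t} - S \<Longrightarrow> p y \<le> p x"
    and x: "x \<in> S"
  shows "0 < p x"
proof (rule ccontr)
  assume "\<not> 0 < p x"
  then have zero: "p y = 0" if "y \<in> {..<w t} - S" for y using S(3)[OF x that] by simp
  have "j * 1 \<le> (\<Sum>c<W. min (p c) (column_height w t (Suc 0) c))"
    using feas t feasible_def[of t p] Suc_leI[OF t] by (metis One_nat_def Suc_eq_plus1)
  also have "\<dots> \<le> (\<Sum>c<W. of_bool (c \<in> S - {x}))"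
    using zero \<open>\<not> 0 < p x\<close> by (intro sum_mono) (auto simp: column_height_Suc column_height_0)
  also have "\<dots> = card (S - {x})"
    using S(1) width[OF t] by (intro sum_of_bool_mem) auto
  also have "\<dots> < j" using S(2) x finite_subset[OF S(1) finite_lessThan] by (metis card_Diff1_less)
  finally show False by simp
qed

lemma filling_step:
  assumes t: "t < a" and fill: "filling t J K" and feas: "feasible t (residual t J)"
    and S: "S \<subseteq> {..<w t}" "card S = j"
      "\<And>x y. x \<in> S \<Longrightarrow> y \<in> {..<w t} - S \<Longrightarrow> residual t J y \<le> residual t J x"
    and T: "T \<subseteq> {..<w t} - S" "card T = l" "\<And>c. c \<in> T \<Longrightarrow> column_degree t K c < iot c"
  shows "\<exists>J K. filling (Suc t) J K \<and> feasible (Suc t) (residual (Suc t) J)"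
proof (intro exI conjI)
  let ?J = "J(t := S)" and ?K = "K(t := T)"
  have J: "column_degree (Suc t) ?J c = column_degree t J c + of_bool (c \<in> S)"
    and K: "column_degree (Suc t) ?K c = column_degree t K c + of_bool (c \<in> T)" for c
    by (simp_all add: column_degree_Suc column_degree_upd)
  have pos: "column_degree t J c < kap c" if "c \<in> S" for c
    using feasible_top_pos[OF t feas S that] by (simp add: residual_def)
  show "filling (Suc t) ?J ?K"
    unfolding filling_def J K
  proof (intro conjI allI impI)
    fix r assume "r < Suc t"
    then show "?J r \<subseteq> {..<w r}" "card (?J r) = j" "?K r \<subseteq> {..<w r}" "card (?K r) = l"
      "?J r \<inter> ?K r = {}"
      using fill S T(1,2) by (cases "r = t"; auto simp: filling_def)+
  next
    fix c
    show "column_degree t J c + of_bool (c \<in> S) \<le> kap c"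
      using fill pos[of c] by (cases "c \<in> S") (auto simp: filling_def)
    show "column_degree t K c + of_bool (c \<in> T) \<le> iot c"
      using fill T(3)[of c] by (cases "c \<in> T") (auto simp: filling_def)
  qed
  have "residual (Suc t) ?J = (\<lambda>c. residual t J c - of_bool (c \<in> S))"
    by (rule ext) (simp add: residual_def J)
  then show "feasible (Suc t) (residual (Suc t) ?J)"
    using feasible_greedy[OF t feas S] by simp
qed

text \<open>The row takes a greedy set \<open>S\<close> for the first family. The second one needs
  \<open>l\<close> columns of \<open>V - S\<close>, where \<open>V\<close> holds the columns with
  \<open>iot\<close> capacity left; if these are too few, one column is gained by altering either an
  earlier set \<open>K r\<close> or \<open>S\<close> itself.\<close>

lemma filling_extend:
  assumes t: "t < a" and fill: "filling t J K" and feas: "feasible t (residual t J)"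
  shows "\<exists>J K. filling (Suc t) J K \<and> feasible (Suc t) (residual (Suc t) J)"
proof -
  define p where "p = residual t J"
  have row: "J r \<subseteq> {..<w r}" "card (J r) = j" "K r \<subseteq> {..<w r}" "card (K r) = l" "J r \<inter> K r = {}"
    if "r < t" for r using fill that unfolding filling_def by blast+
  have degJ: "column_degree t J c \<le> kap c" and degK: "column_degree t K c \<le> iot c" for c
    using fill unfolding filling_def by blast+
  have nested: "{..<w r} \<subseteq> {..<w t}" if "r < t" for r using mono[of r t] t that by auto
  have sumJ: "(\<Sum>c<w t. column_degree t J c) = j * t"
  proof -
    have "J r \<subseteq> {..<w t}" if "r < t" for r
      using row(1)[OF that] nested[OF that] by (rule subset_trans)
    then have "(\<Sum>c<w t. column_degree t J c) = (\<Sum>r<t. card (J r))"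
      by (rule sum_column_degree)
    then show ?thesis using row by simp
  qed
  have sumK: "(\<Sum>c<w t. column_degree t K c) = l * t"
  proof -
    have "K r \<subseteq> {..<w t}" if "r < t" for r
      using row(3)[OF that] nested[OF that] by (rule subset_trans)
    then have "(\<Sum>c<w t. column_degree t K c) = (\<Sum>r<t. card (K r))"
      by (rule sum_column_degree)
    then show ?thesis using row by simp
  qed
  have "j \<le> card {..<w t}"
  proof -
    have "j * 1 \<le> (\<Sum>c<W. min (p c) (column_height w t (Suc 0) c))"
      using feas feasible_def[of t p] Suc_leI[OF t] unfolding p_def by (metis One_nat_def Suc_eq_plus1)
    also have "\<dots> \<le> (\<Sum>c<W. of_bool (c \<in> {..<w t}))"
      by (intro sum_mono) (auto simp: column_height_Suc column_height_0)
    also have "\<dots> = card {..<w t}" using width[OF t] by (intro sum_of_bool_mem) auto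
    finally show ?thesis by simp
  qed
  then obtain S where S: "S \<subseteq> {..<w t}" "card S = j" "\<And>x y. x \<in> S \<Longrightarrow> y \<in> {..<w t} - S \<Longrightarrow> p y \<le> p x"
    using ex_top_subset[of "{..<w t}" j p] by blast
  have finS: "finite S" using S(1) finite_subset by blast
  define V where "V = {c\<in>{..<w t}. column_degree t K c < iot c}"
  have finV: "finite V" and Vw: "V \<subseteq> {..<w t}" by (auto simp: V_def)
  show ?thesis
  proof (cases "l \<le> card (V - S)")
    case True
    then obtain T where "T \<subseteq> V - S" "card T = l" by (meson obtain_subset_with_card_n)
    then show ?thesis
      using filling_step[OF t fill feas S[unfolded p_def]] unfolding V_def by blast
  next
    case False
    then have l: "0 < l" by simp
    \<comment> \<open>Counting shows that \<open>V\<close> has exactly three columns, contains \<open>S\<close>, and is disjoint from all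
      sets \<open>K r\<close> chosen so far; hence \<open>V - S\<close> is only one column short.\<close>
    have sumV: "(\<Sum>c<w t. iot c) = l * t + (\<Sum>c\<in>V. iot c - column_degree t K c)"
    proof -
      have "(\<Sum>c<w t. iot c - column_degree t K c) = (\<Sum>c\<in>V. iot c - column_degree t K c)"
        unfolding V_def by (intro sum.mono_neutral_right) auto
      moreover have "(\<Sum>c<w t. iot c) = (\<Sum>c<w t. column_degree t K c + (iot c - column_degree t K c))"
        using degK by (intro sum.cong) auto
      ultimately show ?thesis using sumK by (simp add: sum.distrib)
    qed
    have Vl: "(\<Sum>c\<in>V. iot c - column_degree t K c) \<le> l * card V"
    proof -
      have "iot c - column_degree t K c \<le> l" for c using iot_le[of c] by linarith
      then show ?thesis
        using sum_bounded_above[of V "\<lambda>c. iot c - column_degree t K c" l] by (simp add: mult.commute)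
    qed
    have V3l: "l * 3 \<le> (\<Sum>c\<in>V. iot c - column_degree t K c)"
      using iot_room[OF t] sumV by (simp add: algebra_simps)
    have "l * 3 \<le> l * card V" using V3l Vl by linarith
    then have "3 \<le> card V" using l by simp
    moreover have cV: "card V = card (V \<inter> S) + card (V - S)"
      using finV by (metis card_Int_Diff)
    moreover have cVS: "card (V \<inter> S) \<le> j" using S(2) finS by (metis Int_lower2 card_mono)
    \<comment> \<open>Three is also the upper bound \<open>j + (l - 1)\<close>, so these estimates
      all hold with equality.\<close>
    ultimately have card: "card V = 3" "card (V - S) + 1 = l" "card (V \<inter> S) = j"
      using False jl by linarith+
    have SV: "S \<subseteq> V" using card(3) S(2) finS by (metis Int_lower1 Int_lower2 card_subset_eq)
    have Veq: "iot c = l" "column_degree t K c = 0" if "c \<in> V" for c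
    proof -
      have "iot c - column_degree t K c = l"
      proof (rule ccontr)
        assume "iot c - column_degree t K c \<noteq> l"
        moreover have le: "iot c - column_degree t K c \<le> l" for c using iot_le[of c] by linarith
        ultimately have "(\<Sum>c\<in>V. iot c - column_degree t K c) < (\<Sum>c\<in>V. l)"
          using that finV by (intro sum_strict_mono_ex1) (auto simp: order_less_le)
        then show False using V3l card by simp
      qed
      then show "iot c = l" "column_degree t K c = 0" using iot_le[of c] l by linarith+
    qed
    have kap_tight: "(\<Sum>c<w t. kap c) \<le> j * (t + 2)"
    proof (rule tight[OF t l])
      show "(\<Sum>c<w t. iot c) = l * (t + 3)"
        using sumV V3l Vl card by (simp add: algebra_simps)
    qed
    show ?thesis
    proof (cases "\<exists>r<t. \<exists>x\<in>V. x < w r \<and> x \<notin> J r")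
      case True
      then obtain r x where rx: "r < t" "x \<in> V" "x < w r" "x \<notin> J r" by blast
      \<comment> \<open>Replacing some \<open>c\<close> by \<open>x\<close> in \<open>K r\<close> releases the saturated column \<open>c\<close>.\<close>
      have xK: "x \<notin> K r" using column_degree_pos[of r t x K] rx Veq by auto
      obtain c where c: "c \<in> K r" using row(4)[OF rx(1)] l by fastforce
      have cV: "c \<notin> V" using column_degree_pos[of r t c K] rx(1) c Veq by auto
      have finK: "finite (K r)" using row(4)[OF rx(1)] l card_ge_0_finite by auto
      define K' where "K' = K(r := insert x (K r - {c}))"
      have xc: "x \<noteq> c" using c xK by auto
      have degK': "column_degree t K' y + of_bool (y = c) = column_degree t K y + of_bool (y = x)" for y
      proof -
        have 1: "column_degree t K'' y = of_bool (y \<in> K'' r) + (\<Sum>i\<in>{..<t} - {r}. of_bool (y \<in> K'' i))" for K''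
          unfolding column_degree_def using rx(1) by (intro sum.remove) auto
        have 2: "(\<Sum>i\<in>{..<t} - {r}. of_bool (y \<in> K' i)) = (\<Sum>i\<in>{..<t} - {r}. of_bool (y \<in> K i) :: nat)"
          unfolding K'_def by (intro sum.cong) auto
        show ?thesis unfolding 1 2 using c xK xc by (auto simp: K'_def)
      qed
      have "filling t J K'"
        unfolding filling_def
      proof (intro conjI allI impI)
        fix i assume i: "i < t"
        show "J i \<subseteq> {..<w i}" "card (J i) = j" using row[OF i] by auto
        show "K' i \<subseteq> {..<w i}" "J i \<inter> K' i = {}"
          using row[OF i] rx by (auto simp: K'_def)
        show "card (K' i) = l"
          using row[OF i] c xK finK l by (auto simp: K'_def card_Diff_singleton)
      next
        fix y
        show "column_degree t J y \<le> kap y" by (rule degJ)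
        show "column_degree t K' y \<le> iot y"
          using degK'[of y] degK[of y] Veq[OF rx(2)] l by (cases "y = x"; cases "y = c") auto
      qed
      moreover have "insert c (V - S) \<subseteq> {..<w t} - S"
        using Vw c row(3)[OF rx(1)] nested[OF rx(1)] cV SV by auto
      moreover have "card (insert c (V - S)) = l" using finV cV card(2) by simp
      moreover have "column_degree t K' y < iot y" if "y \<in> insert c (V - S)" for y
      proof (cases "y = c")
        case True
        then show ?thesis using degK'[of y] degK[of y] xc by simp
      next
        case False
        \<comment> \<open>The column \<open>x\<close> may itself lie in \<open>V - S\<close> and has
          then just been used once. As \<open>V - S\<close> is nonempty, \<open>l\<close> is at
          least 2 and a unit is left.\<close>
        then have y: "y \<in> V - S" using that by simp
        then have "0 < card (V - S)" using finV by (auto simp: card_gt_0_iff)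
        then have "1 < l" using card(2) by simp
        then show ?thesis using degK'[of y] False Veq[of y] y by (cases "y = x") auto
      qed
      ultimately show ?thesis
        using filling_step[OF t _ feas S[unfolded p_def]] by blast
    next
      case False
      \<comment> \<open>Here all boxes of the rows before \<open>t\<close> in the columns of \<open>V\<close> belong to \<open>J\<close>. The joint feasibility then
        yields a column outside \<open>V\<close> that can replace one of the columns of \<open>S\<close>.\<close>
      have height: "column_height w 0 t c = column_degree t J c" if "c \<in> V" for c
        unfolding column_height_def column_degree_def
        using False that row(1) by (intro sum.cong) auto
      have "\<exists>c<w t. c \<notin> V \<and> 0 < p c"
      proof (rule ccontr)
        assume none: "\<not> ?thesis"
        have "4 * Suc t \<le> (\<Sum>c<W. min (kap c + iot c) (column_height w 0 (Suc t) c))"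
          using feasible_both[of "Suc t"] t by simp
        also have "\<dots> = (\<Sum>c<w t. min (kap c + iot c) (column_height w 0 (Suc t) c))"
        proof (intro sum.mono_neutral_right ballI)
          fix c assume c: "c \<in> {..<W} - {..<w t}"
          have "column_height w 0 (Suc t) c = 0"
            unfolding column_height_def
          proof (intro sum.neutral ballI)
            fix r assume "r \<in> {0..<0 + Suc t}"
            then show "of_bool (c < w r) = 0" using mono[of r t] t c by auto
          qed
          then show "min (kap c + iot c) (column_height w 0 (Suc t) c) = 0" by simp
        qed (use width[OF t] in auto)
        \<comment> \<open>In a column of \<open>V\<close> row \<open>t\<close> adds at most one box
          to the load of the first family; every other column is exhausted for both families. The
          total \<open>4 * t + 3\<close> is one short.\<close>
        also have "\<dots> \<le> (\<Sum>c<w t. column_degree t J c + column_degree t K c + of_bool (c \<in> V))"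
        proof (intro sum_mono)
          fix c assume c: "c \<in> {..<w t}"
          show "min (kap c + iot c) (column_height w 0 (Suc t) c)
            \<le> column_degree t J c + column_degree t K c + of_bool (c \<in> V)"
          proof (cases "c \<in> V")
            case True
            have "column_height w 0 (Suc t) c \<le> column_height w 0 t c + 1"
              by (simp add: column_height_def)
            then show ?thesis using True height[OF True] by simp
          next
            case False
            then have "\<not> 0 < p c" using none False c by (metis lessThan_iff)
            then have "kap c \<le> column_degree t J c" by (simp add: p_def residual_def)
            moreover have "iot c \<le> column_degree t K c" using False c by (simp add: V_def)
            ultimately show ?thesis by simp
          qed
        qed
        also have "\<dots> = j * t + l * t + 3"
          using sumJ sumK card(1) Vw by (simp add: sum.distrib sum_of_bool_mem Int_absorb1)
        also have "\<dots> = 4 * t + 3" by (simp add: jl flip: add_mult_distrib)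
        finally show False by simp
      qed
      then obtain c where c: "c < w t" "c \<notin> V" "0 < p c" by blast
      \<comment> \<open>By \<open>kap_tight\<close> the first family has at most
        \<open>2 * j\<close> units left within row \<open>t\<close>. As \<open>c\<close> outside
        \<open>S\<close> holds one of them, the columns of \<open>S\<close> cannot all have
        2.\<close>
      have sump: "(\<Sum>c<w t. p c) \<le> 2 * j"
      proof -
        have "(\<Sum>c<w t. kap c) = (\<Sum>c<w t. column_degree t J c + p c)"
          using degJ by (intro sum.cong) (auto simp: p_def residual_def)
        then show ?thesis using kap_tight sumJ by (simp add: sum.distrib algebra_simps)
      qed
      have pos: "0 < p x" if "x \<in> S" for x
        using feasible_top_pos[OF t feas S[unfolded p_def] that] by (simp add: p_def)
      have "\<exists>x\<in>S. p x \<le> 1"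
      proof (rule ccontr)
        assume none: "\<not> ?thesis"
        have "2 \<le> p x" if "x \<in> S" for x
        proof -
          have "\<not> p x \<le> 1" using none that by blast
          then show ?thesis by simp
        qed
        then have "(\<Sum>x\<in>S. 2) \<le> (\<Sum>x\<in>S. p x)" by (rule sum_mono)
        moreover have "c \<notin> S" using c SV by blast
        ultimately have "2 * j < (\<Sum>x\<in>insert c S. p x)" using S(2) finS c(3) by simp
        also have "\<dots> \<le> (\<Sum>c<w t. p c)" using S(1) c by (intro sum_mono2) auto
        finally show False using sump by simp
      qed
      then obtain x where x: "x \<in> S" "p x = 1" using pos by (metis One_nat_def Suc_leI le_antisym)
      have cS: "c \<notin> S" using c SV by auto
      have top: "p y \<le> 1" if "y \<in> {..<w t} - S" for y using S(3)[OF x(1) that] x by simp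
      have pc: "p c = 1" using top[of c] c cS by simp
      \<comment> \<open>Both \<open>x\<close> and \<open>c\<close> have residual capacity 1, which
        is the smallest value in \<open>S\<close> and the largest one outside. Exchanging them gives
        another greedy choice and releases \<open>x\<close>, a column of \<open>V\<close>.\<close>
      define S' where "S' = insert c (S - {x})"
      have S': "S' \<subseteq> {..<w t}" "card S' = j" "\<And>u v. u \<in> S' \<Longrightarrow> v \<in> {..<w t} - S' \<Longrightarrow> p v \<le> p u"
      proof -
        show "S' \<subseteq> {..<w t}" using S(1) c by (auto simp: S'_def)
        show "card S' = j" using S(2) finS cS x(1) by (simp add: S'_def card_gt_0_iff)
          (metis Suc_pred card_gt_0_iff empty_iff)
        fix u v assume u: "u \<in> S'" and v: "v \<in> {..<w t} - S'"
        have "p v \<le> 1" using v top[of v] x(2) by (cases "v = x") (auto simp: S'_def)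
        moreover have "1 \<le> p u" using u pos[of u] pc by (auto simp: S'_def)
        ultimately show "p v \<le> p u" by simp
      qed
      have "insert x (V - S) \<subseteq> {..<w t} - S'"
        using Vw S(1) x(1) c cS by (auto simp: S'_def)
      moreover have "card (insert x (V - S)) = l" using finV x(1) card(2) by simp
      moreover have "column_degree t K y < iot y" if "y \<in> insert x (V - S)" for y
        using that Veq[of y] x(1) SV l by auto
      ultimately show ?thesis
        using filling_step[OF t fill feas S'[unfolded p_def]] by blast
    qed
  qed
qed

lemma ex_filling: "\<exists>J K. filling a J K"
proof -
  have "\<exists>J K. filling t J K \<and> feasible t (residual t J)" if "t \<le> a" for t
    using that
  proof (induction t)
    case 0
    have "filling 0 (\<lambda>_. {}) (\<lambda>_. {})" by (simp add: filling_def column_degree_def)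
    moreover have "feasible 0 (residual 0 (\<lambda>_. {}))"
      using feasible_init by (simp add: feasible_def residual_def column_degree_def)
    ultimately show ?case by blast
  next
    case (Suc t)
    then show ?case using filling_extend[of t] by auto
  qed
  then show ?thesis by blast
qed

end

section \<open>Young diagrams and their arms\<close>

definition row_degree :: "(nat \<times> nat) set \<Rightarrow> nat \<Rightarrow> nat" where
  "row_degree S r = card {c. (r, c) \<in> S}"

definition col_degree :: "(nat \<times> nat) set \<Rightarrow> nat \<Rightarrow> nat" where
  "col_degree S c = card {r. (r, c) \<in> S}"

definition quadrant :: "(nat \<times> nat) set \<Rightarrow> nat \<Rightarrow> nat \<Rightarrow> (nat \<times> nat) set" where
  "quadrant Y x y = {(r, c) \<in> Y. x \<le> r \<and> y \<le> c}"

lemma finite_column: "finite S \<Longrightarrow> finite {r. (r, c) \<in> S}"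
  by (rule finite_subset[of _ "fst ` S"]) force+

lemma finite_row: "finite S \<Longrightarrow> finite {c. (r, c) \<in> S}"
  by (rule finite_subset[of _ "snd ` S"]) force+

lemma card_eq_sum_col_degree:
  assumes "finite S" "\<And>r c. (r, c) \<in> S \<Longrightarrow> c \<in> C" "finite C"
  shows "card S = (\<Sum>c\<in>C. col_degree S c)"
proof -
  have "S = (\<Union>c\<in>C. (\<lambda>r. (r, c)) ` {r. (r, c) \<in> S})" using assms(2) by auto
  then have "card S = card (\<Union>c\<in>C. (\<lambda>r. (r, c)) ` {r. (r, c) \<in> S})" by simp
  also have "\<dots> = (\<Sum>c\<in>C. card ((\<lambda>r. (r, c)) ` {r. (r, c) \<in> S}))"
    using assms finite_column[OF assms(1)] by (intro card_UN_disjoint) auto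
  also have "\<dots> = (\<Sum>c\<in>C. col_degree S c)"
    unfolding col_degree_def by (intro sum.cong refl card_image) (auto simp: inj_on_def)
  finally show ?thesis .
qed

lemma col_degree_Un:
  assumes "finite A" "finite B" "A \<inter> B = {}"
  shows "col_degree (A \<union> B) c = col_degree A c + col_degree B c"
proof -
  have "{r. (r, c) \<in> A \<union> B} = {r. (r, c) \<in> A} \<union> {r. (r, c) \<in> B}" by auto
  moreover have "{r. (r, c) \<in> A} \<inter> {r. (r, c) \<in> B} = {}" using assms(3) by auto
  ultimately show ?thesis
    unfolding col_degree_def using finite_column[OF assms(1)] finite_column[OF assms(2)]
    by (simp only: card_Un_disjoint)
qed

lemma down_closed_eq_lessThan:
  assumes "finite A" "\<And>x y. x \<in> A \<Longrightarrow> y \<le> x \<Longrightarrow> y \<in> A"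
  shows "c \<in> A \<longleftrightarrow> c < card (A :: nat set)"
proof
  assume "c \<in> A"
  then have "card {..c} \<le> card A" using assms by (intro card_mono) auto
  then show "c < card A" by simp
next
  assume c: "c < card A"
  show "c \<in> A"
  proof (rule ccontr)
    assume "c \<notin> A"
    then have "A \<subseteq> {..<c}" using assms(2) by (meson lessThan_iff not_less subsetI)
    then have "card A \<le> card {..<c}" by (intro card_mono) auto
    then show False using c by simp
  qed
qed

text \<open>The monotone functions cross at most once: before the first \<open>y\<close> with
  \<open>g y \<le> f y\<close> the minimum is \<open>f\<close>, from there on it is
  \<open>g\<close>.\<close>

lemma sum_min_threshold:
  fixes f g :: "nat \<Rightarrow> nat"
  assumes f: "\<And>x y. x \<le> y \<Longrightarrow> f x \<le> f y" and g: "\<And>x y. x \<le> y \<Longrightarrow> g y \<le> g x"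
  shows "\<exists>y\<le>n. (\<Sum>i<n. min (f i) (g i)) = (\<Sum>i<y. f i) + (\<Sum>i\<in>{y..<n}. g i)"
proof -
  define y where "y = (LEAST y. y = n \<or> g y \<le> f y)"
  have y: "y = n \<or> g y \<le> f y" unfolding y_def by (rule LeastI[of _ n]) simp
  have yn: "y \<le> n" unfolding y_def by (rule Least_le) simp
  have low: "f i \<le> g i" if "i < y" for i
    using not_less_Least[of i "\<lambda>y. y = n \<or> g y \<le> f y"] that unfolding y_def by simp
  have high: "g i \<le> f i" if "y \<le> i" "i < n" for i
  proof -
    have "g y \<le> f y" using y that by auto
    then show ?thesis using f[OF that(1)] g[OF that(1)] by linarith
  qed
  have "(\<Sum>i<n. min (f i) (g i)) = (\<Sum>i<y. min (f i) (g i)) + (\<Sum>i\<in>{y..<n}. min (f i) (g i))"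
    using sum.atLeastLessThan_concat[of 0 y n "\<lambda>i. min (f i) (g i)"] yn
    by (simp add: atLeast0LessThan)
  also have "(\<Sum>i<y. min (f i) (g i)) = (\<Sum>i<y. f i)"
    using low by (intro sum.cong) auto
  also have "(\<Sum>i\<in>{y..<n}. min (f i) (g i)) = (\<Sum>i\<in>{y..<n}. g i)"
    using high by (intro sum.cong) auto
  finally show ?thesis using yn by blast
qed

text \<open>Down-closed sets, unlike lists of row lengths, are visibly invariant under
  transposition: what is proved for one arm is applied to \<open>Y\<inverse>\<close> for the
  other.\<close>

locale young_set =
  fixes Y :: "(nat \<times> nat) set"
  assumes fin: "finite Y"
    and down: "\<And>r c r' c'. (r, c) \<in> Y \<Longrightarrow> r' \<le> r \<Longrightarrow> c' \<le> c \<Longrightarrow> (r', c') \<in> Y"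
begin

lemma mem_iff_row: "(r, c) \<in> Y \<longleftrightarrow> c < row_degree Y r"
  unfolding row_degree_def
  using down_closed_eq_lessThan[of "{c. (r, c) \<in> Y}" c] finite_row[OF fin] down by blast

lemma row_degree_antimono: "r \<le> r' \<Longrightarrow> row_degree Y r' \<le> row_degree Y r"
  unfolding row_degree_def using finite_row[OF fin] down by (intro card_mono) auto

lemma finite_quadrant: "finite (quadrant Y x y)"
  by (rule finite_subset[OF _ fin]) (auto simp: quadrant_def)

lemma col_degree_quadrant_antimono:
  assumes "b \<le> c" "c \<le> c'"
  shows "col_degree (quadrant Y a b) c' \<le> col_degree (quadrant Y a b) c"
  unfolding col_degree_def
proof (rule card_mono)
  show "finite {r. (r, c) \<in> quadrant Y a b}" by (rule finite_column[OF finite_quadrant])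
  show "{r. (r, c') \<in> quadrant Y a b} \<subseteq> {r. (r, c) \<in> quadrant Y a b}"
    using assms down by (auto simp: quadrant_def)
qed

text \<open>The arm consists of the rows \<open>< a\<close> and the columns \<open>\<ge> b\<close>. Its rows are numbered from the
  bottom, so that their widths increase.\<close>

definition arm_width :: "nat \<Rightarrow> nat \<Rightarrow> nat \<Rightarrow> nat" where
  "arm_width a b t = row_degree Y (a - 1 - t) - b"

lemma arm_width_mono: "t \<le> t' \<Longrightarrow> arm_width a b t \<le> arm_width a b t'"
  unfolding arm_width_def using row_degree_antimono[of "a - 1 - t'" "a - 1 - t"]
  by (simp add: diff_le_mono diff_le_mono2)

lemma mem_arm: "t < a \<Longrightarrow> (a - 1 - t, i + b) \<in> Y \<longleftrightarrow> i < arm_width a b t"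
  unfolding mem_iff_row arm_width_def by auto

text \<open>A column of the quadrant consists of its part in the core and of boxes in the
  \<open>s\<close> rows just above; in the numbering from the bottom these are the first
  \<open>s\<close> rows of the arm.\<close>

lemma col_degree_quadrant:
  assumes s: "s \<le> a"
  shows "col_degree (quadrant Y (a - s) (y + b)) (i + b) =
    (if y \<le> i then column_height (arm_width a b) 0 s i + col_degree (quadrant Y a b) (i + b) else 0)"
proof (cases "y \<le> i")
  case True
  define A where "A = {r. a - s \<le> r \<and> r < a \<and> (r, i + b) \<in> Y}"
  define B where "B = {r. (r, i + b) \<in> quadrant Y a b}"
  have "{r. (r, i + b) \<in> quadrant Y (a - s) (y + b)} = A \<union> B"
    using True s by (auto simp: A_def B_def quadrant_def)
  moreover have "A \<inter> B = {}" by (auto simp: A_def B_def quadrant_def)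
  moreover have "finite A" by (simp add: A_def)
  moreover have "finite B" unfolding B_def by (rule finite_column[OF finite_quadrant])
  ultimately have 1: "col_degree (quadrant Y (a - s) (y + b)) (i + b) = card A + card B"
    unfolding col_degree_def by (simp add: card_Un_disjoint)
  have "bij_betw (\<lambda>t. a - 1 - t) {t\<in>{..<s}. i < arm_width a b t} A"
  proof (rule bij_betw_byWitness[where f' = "\<lambda>r. a - 1 - r"])
    show "(\<lambda>t. a - 1 - t) ` {t \<in> {..<s}. i < arm_width a b t} \<subseteq> A"
      using s mem_arm by (auto simp: A_def)
    show "(\<lambda>r. a - 1 - r) ` A \<subseteq> {t \<in> {..<s}. i < arm_width a b t}"
    proof (intro image_subsetI)
      fix r assume r: "r \<in> A"
      then have "a - 1 - (a - 1 - r) = r" "a - 1 - r < s" "a - 1 - r < a" by (auto simp: A_def)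
      then show "a - 1 - r \<in> {t \<in> {..<s}. i < arm_width a b t}"
        using r mem_arm[of "a - 1 - r" a i b] by (simp add: A_def)
    qed
  qed (use s in \<open>auto simp: A_def\<close>)
  then have "card A = card {t\<in>{..<s}. i < arm_width a b t}" by (simp add: bij_betw_same_card)
  also have "\<dots> = column_height (arm_width a b) 0 s i"
    by (simp add: column_height_def Int_def atLeast0LessThan)
  finally show ?thesis using 1 True by (simp add: B_def col_degree_def)
next
  case False
  then have "{r. (r, i + b) \<in> quadrant Y (a - s) (y + b)} = {}" by (auto simp: quadrant_def)
  then show ?thesis using False by (simp only: col_degree_def card.empty if_False)
qed

lemma card_quadrant:
  assumes s: "s \<le> a" and W: "row_degree Y 0 \<le> W" and y: "y \<le> W"
  shows "card (quadrant Y (a - s) (y + b)) =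
    (\<Sum>i\<in>{y..<W}. column_height (arm_width a b) 0 s i + col_degree (quadrant Y a b) (i + b))"
proof -
  have "card (quadrant Y (a - s) (y + b))
    = (\<Sum>c\<in>{y + b..<W + b}. col_degree (quadrant Y (a - s) (y + b)) c)"
  proof (rule card_eq_sum_col_degree[OF finite_quadrant])
    fix r c assume "(r, c) \<in> quadrant Y (a - s) (y + b)"
    then show "c \<in> {y + b..<W + b}"
      using mem_iff_row[of r c] row_degree_antimono[of 0 r] W by (auto simp: quadrant_def)
  qed simp
  also have "\<dots> = (\<Sum>i\<in>{y..<W}. col_degree (quadrant Y (a - s) (y + b)) (i + b))"
    by (rule sum.shift_bounds_nat_ivl)
  also have "\<dots> = (\<Sum>i\<in>{y..<W}. column_height (arm_width a b) 0 s i
      + col_degree (quadrant Y a b) (i + b))"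
    by (intro sum.cong) (auto simp: col_degree_quadrant[OF s])
  finally show ?thesis .
qed

lemma column_height_arm_antimono:
  "x \<le> y \<Longrightarrow> column_height (arm_width a b) t s y \<le> column_height (arm_width a b) t s x"
  unfolding column_height_def by (intro sum_mono) auto

text \<open>The minimum on the right is, for a suitable threshold \<open>y\<close>, the part of the cut bound
  coming from the first \<open>a - s\<close> rows and the first \<open>b + y\<close> columns.\<close>

lemma cut_bound_imp_feasible:
  assumes cut: "\<And>x y. k * (a + b) + card (quadrant Y a b) \<le> k * (x + y) + card (quadrant Y x y)"
    and le: "\<And>c. col_degree (quadrant Y a b) c \<le> k"
    and s: "s \<le> a" and W: "row_degree Y 0 \<le> W"
  shows "k * s \<le> (\<Sum>i<W. min (k - col_degree (quadrant Y a b) (i + b))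
    (column_height (arm_width a b) 0 s i))"
proof -
  define nu where "nu i = col_degree (quadrant Y a b) (i + b)" for i
  define H where "H = column_height (arm_width a b) 0 s"
  have "k - nu x \<le> k - nu y" if "x \<le> y" for x y
    using col_degree_quadrant_antimono[of b "x + b" "y + b" a] that unfolding nu_def
    by (intro diff_le_mono2) simp
  moreover have "H y \<le> H x" if "x \<le> y" for x y
    unfolding H_def by (rule column_height_arm_antimono[OF that])
  ultimately obtain y where y: "y \<le> W"
    "(\<Sum>i<W. min (k - nu i) (H i)) = (\<Sum>i<y. k - nu i) + (\<Sum>i\<in>{y..<W}. H i)"
    using sum_min_threshold[of "\<lambda>i. k - nu i" H W] by auto
  have "card (quadrant Y a b) = (\<Sum>i\<in>{0..<W}. nu i)"
    using card_quadrant[of 0 a W 0 b] W by (simp add: nu_def column_height_0)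
  also have "\<dots> = (\<Sum>i<y. nu i) + (\<Sum>i\<in>{y..<W}. nu i)"
    using sum.atLeastLessThan_concat[of 0 y W nu] y by (simp add: atLeast0LessThan)
  finally have 1: "card (quadrant Y a b) = (\<Sum>i<y. nu i) + (\<Sum>i\<in>{y..<W}. nu i)" .
  have 2: "card (quadrant Y (a - s) (y + b)) = (\<Sum>i\<in>{y..<W}. H i) + (\<Sum>i\<in>{y..<W}. nu i)"
    using card_quadrant[OF s W y(1)] by (simp add: H_def nu_def sum.distrib)
  have "(\<Sum>i<y. k - nu i) + (\<Sum>i<y. nu i) = (\<Sum>i<y. k)"
    unfolding sum.distrib[symmetric] using le by (intro sum.cong) (auto simp: nu_def)
  then have 3: "(\<Sum>i<y. k - nu i) + (\<Sum>i<y. nu i) = k * y" by simp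
  have "k * (a + b) = k * s + k * (a - s + b)" "k * (a - s + (y + b)) = k * y + k * (a - s + b)"
    using le_Suc_ex[OF s] by (auto simp: algebra_simps)
  then show ?thesis
    using cut[of "a - s" "y + b"] 1 2 3 y(2) unfolding nu_def[symmetric] H_def[symmetric] by linarith
qed

text \<open>A cut through the end of row \<open>r\<close> leaves an empty quadrant, so there the cut
  inequality is a lower bound for the length of that row.\<close>

lemma arm_width_ge:
  assumes cut: "\<And>x y. a + b + m \<le> x + y + card (quadrant Y x y)" and t: "t < a"
  shows "t + 1 + m \<le> arm_width a b t"
proof -
  define r where "r = a - 1 - t"
  have "quadrant Y r (row_degree Y r) = {}"
    unfolding quadrant_def mem_iff_row using row_degree_antimono[of r] by (force dest: leD)
  then show ?thesis
    using cut[of r "row_degree Y r"] t by (simp add: r_def arm_width_def)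
qed

lemma sum_col_degree_eq:
  assumes "S \<subseteq> quadrant Y a b" "\<And>r c. (r, c) \<in> S \<Longrightarrow> c < n + b"
  shows "(\<Sum>i<n. col_degree S (i + b)) = card S"
proof -
  have "card S = (\<Sum>c\<in>{0 + b..<n + b}. col_degree S c)"
    using assms finite_subset[OF assms(1) finite_quadrant]
    by (intro card_eq_sum_col_degree) (auto simp: quadrant_def)
  then show ?thesis by (simp only: sum.shift_bounds_nat_ivl atLeast0LessThan)
qed

lemma sum_col_degree_le:
  assumes "S \<subseteq> quadrant Y a b"
  shows "(\<Sum>i<n. col_degree S (i + b)) \<le> card S"
proof -
  have S': "{(r, c) \<in> S. c < n + b} \<subseteq> quadrant Y a b" using assms by auto
  have "(\<Sum>i<n. col_degree S (i + b)) = (\<Sum>i<n. col_degree {(r, c) \<in> S. c < n + b} (i + b))"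
    by (intro sum.cong) (auto simp: col_degree_def)
  also have "\<dots> = card {(r, c) \<in> S. c < n + b}" by (rule sum_col_degree_eq[OF S']) auto
  also have "\<dots> \<le> card S"
    using finite_subset[OF assms finite_quadrant] by (intro card_mono) auto
  finally show ?thesis .
qed

text \<open>The column capacities are what the core parts \<open>P\<close> and \<open>Q\<close>
  leave over from \<open>j\<close> and \<open>l\<close>; \<open>cut4\<close> and \<open>cutj\<close>
  provide the two Hall conditions, and \<open>cut1\<close> bounds the widths of the rows from below.
  In the first alternative of \<open>split\<close> the core is all of \<open>P\<close>; in the
  second \<open>Q\<close> is small and \<open>P\<close> nearly exhausts the capacity
  \<open>j\<close> of the first three columns.\<close>

lemma arm_filling:
  assumes nu: "P \<union> Q = quadrant Y a b" "P \<inter> Q = {}"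
    and small: "\<And>r c. (r, c) \<in> quadrant Y a b \<Longrightarrow> c < 3 + b"
    and jl: "j + l = 4"
    and cut4: "\<And>x y. 4 * (a + b) + card (quadrant Y a b) \<le> 4 * (x + y) + card (quadrant Y x y)"
    and cutj: "\<And>x y. j * (a + b) + card P \<le> j * (x + y) + card (quadrant Y x y)"
    and cut1: "\<And>x y. a + b + m \<le> x + y + card (quadrant Y x y)"
    and degP: "\<And>c. col_degree P c \<le> j" and degQ: "\<And>c. col_degree Q c \<le> l"
    and split: "Q = {} \<and> (0 < l \<longrightarrow> 2 \<le> m \<and> j \<le> card P) \<or>
      3 \<le> m \<and> card Q \<le> l \<and> 2 * j \<le> card P \<and> (\<forall>i<3. j \<le> col_degree P (i + b) + 1)"
  shows "\<exists>J K. J \<subseteq> Y \<and> K \<subseteq> Y \<and> J \<inter> K = {} \<and>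
    (\<forall>(r, c) \<in> J \<union> K. r < a \<and> b \<le> c) \<and> (\<forall>r<a. row_degree J r = j \<and> row_degree K r = l) \<and>
    (\<forall>c. col_degree J c + col_degree P c \<le> j \<and> col_degree K c + col_degree Q c \<le> l)"
proof -
  define w where "w = arm_width a b"
  define W where "W = row_degree Y 0"
  define kap where "kap i = j - col_degree P (i + b)" for i
  define iot where "iot i = l - col_degree Q (i + b)" for i
  have finPQ: "finite P" "finite Q" using nu(1) finite_quadrant[of a b] by (metis finite_Un)+
  have PQ: "P \<subseteq> quadrant Y a b" "Q \<subseteq> quadrant Y a b" using nu by auto
  have deg_nu: "col_degree (quadrant Y a b) c = col_degree P c + col_degree Q c" for c
    unfolding nu(1)[symmetric] by (rule col_degree_Un[OF finPQ nu(2)])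
  have wide: "t + 1 + m \<le> w t" if "t < a" for t
    unfolding w_def by (rule arm_width_ge[OF cut1 that])
  have sumP: "(\<Sum>i<n. col_degree P (i + b)) = card P" if "3 \<le> n" for n
  proof (rule sum_col_degree_eq[OF PQ(1)])
    fix r c assume "(r, c) \<in> P"
    then show "c < n + b" using small[of r c] PQ(1) that by fastforce
  qed
  have sumK: "(\<Sum>i<n. kap i) + card P = j * n" if "3 \<le> n" for n
  proof -
    have "(\<Sum>i<n. kap i) + (\<Sum>i<n. col_degree P (i + b)) = (\<Sum>i<n. j)"
      unfolding sum.distrib[symmetric] kap_def using degP by (intro sum.cong) auto
    then show ?thesis using sumP[OF that] by simp
  qed
  have sumI: "l * n \<le> (\<Sum>i<n. iot i) + card Q" for n
  proof -
    have "(\<Sum>i<n. iot i) + (\<Sum>i<n. col_degree Q (i + b)) = (\<Sum>i<n. l)"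
      unfolding sum.distrib[symmetric] iot_def using degQ by (intro sum.cong) auto
    then show ?thesis using sum_col_degree_le[OF PQ(2), of n] by (simp add: mult.commute)
  qed
  \<comment> \<open>Width \<open>t + 3\<close> suffices if \<open>Q\<close> is empty. Otherwise
    \<open>m \<ge> 3\<close> yields one more column, which pays for
    \<open>card Q \<le> l\<close>.\<close>
  have room: "l * (t + 3) + card Q \<le> l * w t" if "t < a" for t
  proof (cases "l = 0")
    case True
    then have "Q = {}" using split finPQ by auto
    then show ?thesis using True by simp
  next
    case False
    show ?thesis
    proof (cases "Q = {}")
      case True
      have "2 \<le> m" using split
      proof
        assume "Q = {} \<and> (0 < l \<longrightarrow> 2 \<le> m \<and> j \<le> card P)"
        then show ?thesis using False by simp
      qed simp
      then have "t + 3 \<le> w t" using wide[OF that] by linarith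
      then show ?thesis using True by simp
    next
      case nonempty: False
      then have "t + 4 \<le> w t" "card Q \<le> l" using split wide[OF that] by auto
      then have "l * (t + 4) \<le> l * w t" by simp
      then show ?thesis using \<open>card Q \<le> l\<close> by (simp add: algebra_simps)
    qed
  qed
  interpret nested_rows w a W j l kap iot
  proof
    show "w r \<le> w r'" if "r \<le> r'" "r' < a" for r r'
      unfolding w_def by (rule arm_width_mono[OF that(1)])
    show "w r \<le> W" if "r < a" for r
      using row_degree_antimono[of 0 "a - 1 - r"] by (simp add: w_def W_def arm_width_def)
    show "j + l = 4" by (rule jl)
    show "iot c \<le> l" for c by (simp add: iot_def)
    show "4 * s \<le> (\<Sum>c<W. min (kap c + iot c) (column_height w 0 s c))" if "s \<le> a" for s
    proof -
      have "col_degree (quadrant Y a b) c \<le> 4" for c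
        unfolding deg_nu using degP[of c] degQ[of c] jl by linarith
      moreover have "kap c + iot c = 4 - col_degree (quadrant Y a b) (c + b)" for c
        unfolding deg_nu kap_def iot_def using degP[of "c + b"] degQ[of "c + b"] jl by linarith
      ultimately show ?thesis
        using cut_bound_imp_feasible[OF cut4 _ that, of W] by (simp add: W_def w_def)
    qed
    show "j * s \<le> (\<Sum>c<W. min (kap c) (column_height w 0 s c))" if "s \<le> a" for s
    proof (cases "Q = {} \<or> s = 0")
      case True
      then show ?thesis
      proof
        assume "Q = {}"
        then have "P = quadrant Y a b" using nu by simp
        then show ?thesis
          using cut_bound_imp_feasible[of j a b s W] cutj degP that by (simp add: W_def w_def kap_def)
      qed simp
    next
      case False
      \<comment> \<open>Now the core is larger than \<open>P\<close>, so \<open>cutj\<close> does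
        not have the form treated before. It is applied only at \<open>z \<ge> 3\<close>, to the
        right of the core; in the first three columns \<open>kap\<close> is at most 1 and does not
        exceed the height.\<close>
      define H where "H = column_height w 0 s"
      have m: "3 \<le> m" using split False by auto
      have full: "j \<le> col_degree P (i + b) + 1" if "i < 3" for i
        using split False that by auto
      have "0 < a" using False that by simp
      have W4: "4 \<le> W"
        using wide[OF \<open>0 < a\<close>] m row_degree_antimono[of 0 "a - 1"]
        by (simp add: w_def W_def arm_width_def)
      have H_pos: "1 \<le> H i" if "i < 3" for i
      proof -
        have "i < w 0" using wide[OF \<open>0 < a\<close>] m that by simp
        then have "0 < H i"
          unfolding H_def column_height_def using False by (intro sum_pos2[of _ 0]) auto
        then show ?thesis by simp
      qed
      \<comment> \<open>The value 0 takes the first three columns out of the threshold argument;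
        their share \<open>kap\<close> is added back at the end.\<close>
      have "(if x < 3 then 0 else j) \<le> (if y < 3 then 0 else j)" if "x \<le> y" for x y :: nat
        using that by auto
      moreover have "H y \<le> H x" if "x \<le> y" for x y
        unfolding H_def w_def by (rule column_height_arm_antimono[OF that])
      ultimately obtain y where y: "y \<le> W" "(\<Sum>i<W. min (if i < 3 then 0 else j) (H i))
          = (\<Sum>i<y. if i < 3 then 0 else j) + (\<Sum>i\<in>{y..<W}. H i)"
        using sum_min_threshold[of "\<lambda>i. if i < 3 then 0 else j" H W] by blast
      define z where "z = max y 3"
      have z: "3 \<le> z" "z \<le> W" using y(1) W4 by (auto simp: z_def)
      have "(\<Sum>i<y. if i < 3 then 0 else j) = j * (z - 3)"
      proof -
        have "(\<Sum>i<y. if i < 3 then 0 else j) = (\<Sum>i\<in>{3..<y}. j)"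
          by (intro sum.mono_neutral_cong_right) auto
        moreover have "z - 3 = y - 3" by (auto simp: z_def max_def)
        ultimately show ?thesis by simp
      qed
      moreover have "(\<Sum>i\<in>{z..<W}. H i) \<le> (\<Sum>i\<in>{y..<W}. H i)"
        by (intro sum_mono2) (auto simp: z_def)
      ultimately have tail: "j * (z - 3) + (\<Sum>i\<in>{z..<W}. H i)
          \<le> (\<Sum>i<W. min (if i < 3 then 0 else j) (H i))"
        using y(2) by linarith
      have "card (quadrant Y (a - s) (z + b)) = (\<Sum>i\<in>{z..<W}. H i)"
      proof -
        have "col_degree (quadrant Y a b) (i + b) = 0" if "i \<in> {z..<W}" for i
        proof -
          have "{r. (r, i + b) \<in> quadrant Y a b} = {}" using small that z by force
          then show ?thesis by (simp only: col_degree_def card.empty)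
        qed
        then show ?thesis
          using card_quadrant[OF \<open>s \<le> a\<close> _ z(2)] by (simp add: H_def W_def w_def)
      qed
      then have "j * (a + b) + card P \<le> j * (a - s + (z + b)) + (\<Sum>i\<in>{z..<W}. H i)"
        using cutj[of "a - s" "z + b"] by simp
      moreover have "j * (a + b) = j * s + j * (a - s + b)"
        "j * (a - s + (z + b)) = j * (z - 3) + j * 3 + j * (a - s + b)"
        using le_Suc_ex[OF \<open>s \<le> a\<close>] le_Suc_ex[OF z(1)] by (auto simp: algebra_simps)
      ultimately have cut: "j * s + card P \<le> j * (z - 3) + j * 3 + (\<Sum>i\<in>{z..<W}. H i)"
        by linarith
      have "min (if i < 3 then 0 else j) (H i) + (if i < 3 then kap i else 0) \<le> min (kap i) (H i)" for i
      proof (cases "i < 3")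
        case True
        then have "kap i \<le> H i" using full[OF True] H_pos[OF True] by (simp add: kap_def)
        then show ?thesis using True by simp
      next
        case False
        then have "{r. (r, i + b) \<in> P} = {}" using small PQ(1) by force
        then have "col_degree P (i + b) = 0" by (simp only: col_degree_def card.empty)
        then show ?thesis using False by (simp add: kap_def)
      qed
      then have "(\<Sum>i<W. min (if i < 3 then 0 else j) (H i) + (if i < 3 then kap i else 0))
          \<le> (\<Sum>i<W. min (kap i) (H i))"
        by (rule sum_mono)
      moreover have "(\<Sum>i<W. if i < 3 then kap i else 0) = (\<Sum>i<3. kap i)"
        using W4 by (intro sum.mono_neutral_cong_right) auto
      ultimately have "(\<Sum>i<W. min (if i < 3 then 0 else j) (H i)) + (\<Sum>i<3. kap i)
          \<le> (\<Sum>i<W. min (kap i) (H i))"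
        by (simp only: sum.distrib)
      then show ?thesis using cut tail sumK[of 3] unfolding H_def[symmetric] by linarith
    qed
    show "l * (t + 3) \<le> (\<Sum>c<w t. iot c)" if "t < a" for t
      using room[OF that] sumI[of "w t"] by linarith
    show "(\<Sum>c<w t. kap c) \<le> j * (t + 2)"
      if "t < a" "0 < l" "(\<Sum>c<w t. iot c) = l * (t + 3)" for t
    proof -
      have le: "l * w t \<le> l * (t + 3) + card Q" using sumI[of "w t"] that(3) by simp
      have "2 \<le> m" using split that(2) by auto
      then have "3 \<le> w t" using wide[OF that(1)] by linarith
      then have sum: "(\<Sum>i<w t. kap i) + card P = j * w t" by (rule sumK)
      \<comment> \<open>Equality bounds the width by \<open>t + 3\<close> or \<open>t + 4\<close> in
        the two alternatives. Subtracting \<open>card P\<close>, which is at least \<open>j\<close>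
        or \<open>2 * j\<close>, from \<open>j * w t\<close> leaves at most
        \<open>j * (t + 2)\<close>.\<close>
      show ?thesis using split
      proof
        assume "Q = {} \<and> (0 < l \<longrightarrow> 2 \<le> m \<and> j \<le> card P)"
        then have "w t \<le> t + 3" "j \<le> card P" using le that(2) by auto
        then have "j * w t \<le> j * (t + 3)" by simp
        then show ?thesis using sum \<open>j \<le> card P\<close> by (simp add: algebra_simps)
      next
        assume Q: "3 \<le> m \<and> card Q \<le> l \<and> 2 * j \<le> card P \<and> (\<forall>i<3. j \<le> col_degree P (i + b) + 1)"
        then have "l * w t \<le> l * (t + 4)" using le by (simp add: algebra_simps)
        then have "j * w t \<le> j * (t + 4)" using that(2) by simp
        then show ?thesis using sum Q by (simp add: algebra_simps)
      qed
    qed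
  qed
  obtain Jf Kf where fill: "filling a Jf Kf" using ex_filling by blast
  have row: "Jf t \<subseteq> {..<w t}" "card (Jf t) = j" "Kf t \<subseteq> {..<w t}" "card (Kf t) = l" "Jf t \<inter> Kf t = {}"
    if "t < a" for t using fill that unfolding filling_def by blast+
  have degJ: "column_degree a Jf i \<le> kap i" and degK: "column_degree a Kf i \<le> iot i" for i
    using fill unfolding filling_def by blast+
  \<comment> \<open>This undoes the renumbering: row \<open>t\<close> of the filling becomes row
    \<open>a - 1 - t\<close> of the diagram, and columns are shifted by \<open>b\<close>.\<close>
  define place where "place F = {(r, c). r < a \<and> b \<le> c \<and> c - b \<in> F (a - 1 - r)}" for F :: "nat \<Rightarrow> nat set"
  have place_Y: "place F \<subseteq> Y" if "\<And>t. t < a \<Longrightarrow> F t \<subseteq> {..<w t}" for F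
  proof
    fix e assume "e \<in> place F"
    then obtain r c where e: "e = (r, c)" "r < a" "b \<le> c" "c - b \<in> F (a - 1 - r)"
      by (auto simp: place_def)
    have t: "a - 1 - r < a" using e(2) by simp
    have "c - b < w (a - 1 - r)" using that[OF t] e(4) by auto
    then have "(a - 1 - (a - 1 - r), c - b + b) \<in> Y" unfolding w_def mem_arm[OF t] .
    then show "e \<in> Y" using e by simp
  qed
  have place_row: "row_degree (place F) r = card (F (a - 1 - r))" if "r < a" for F r
  proof -
    have "{c. (r, c) \<in> place F} = (\<lambda>i. i + b) ` F (a - 1 - r)"
      using that by (force simp: place_def image_iff)
    then show ?thesis unfolding row_degree_def by (simp add: card_image inj_on_def)
  qed
  have place_col: "col_degree (place F) c = (if b \<le> c then column_degree a F (c - b) else 0)" for F c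
  proof (cases "b \<le> c")
    case True
    have "bij_betw (\<lambda>t. a - 1 - t) {t\<in>{..<a}. c - b \<in> F t} {r. (r, c) \<in> place F}"
      by (rule bij_betw_byWitness[where f' = "\<lambda>r. a - 1 - r"]) (use True in \<open>auto simp: place_def\<close>)
    then have "col_degree (place F) c = card {t\<in>{..<a}. c - b \<in> F t}"
      unfolding col_degree_def by (simp add: bij_betw_same_card)
    also have "\<dots> = column_degree a F (c - b)" by (simp add: column_degree_def Int_def)
    finally show ?thesis using True by simp
  qed (simp add: col_degree_def place_def)
  have zero: "col_degree S c = 0" if "c < b" "S \<subseteq> quadrant Y a b" for S c
  proof -
    have "{r. (r, c) \<in> S} = {}" using that by (auto simp: quadrant_def)
    then show ?thesis by (simp only: col_degree_def card.empty)
  qed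
  show ?thesis
  proof (intro exI conjI)
    show "place Jf \<subseteq> Y" "place Kf \<subseteq> Y" using place_Y row by auto
    show "place Jf \<inter> place Kf = {}"
    proof -
      have False if "(r, c) \<in> place Jf" "(r, c) \<in> place Kf" for r c
        using that row(5)[of "a - 1 - r"] by (auto simp: place_def)
      then show ?thesis by auto
    qed
    show "\<forall>(r, c)\<in>place Jf \<union> place Kf. r < a \<and> b \<le> c" by (auto simp: place_def)
    show "\<forall>r<a. row_degree (place Jf) r = j \<and> row_degree (place Kf) r = l"
      using place_row row by simp
    show "\<forall>c. col_degree (place Jf) c + col_degree P c \<le> j \<and> col_degree (place Kf) c + col_degree Q c \<le> l"
    proof
      fix c
      show "col_degree (place Jf) c + col_degree P c \<le> j \<and> col_degree (place Kf) c + col_degree Q c \<le> l"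
      proof (cases "b \<le> c")
        case True
        then show ?thesis
          using degJ[of "c - b"] degK[of "c - b"] degP[of c] degQ[of c]
          by (auto simp: place_col kap_def iot_def)
      next
        case False
        then show ?thesis using zero[OF _ PQ(1), of c] zero[OF _ PQ(2), of c] by (simp add: place_col)
      qed
    qed
  qed
qed

end

section \<open>The core of an optimal cut\<close>

lemma sum_lessThan_3: "(\<Sum>i<3. f i) = f 0 + f 1 + f (2::nat)"
  by (simp add: numeral_3_eq_3 numeral_2_eq_2)

lemma row_degree_grid:
  assumes "S \<subseteq> {..<3} \<times> {..<3}"
  shows "row_degree S r = of_bool ((r, 0) \<in> S) + of_bool ((r, 1) \<in> S) + of_bool ((r, 2) \<in> S)"
proof -
  have "{c. (r, c) \<in> S} = {..<3} \<inter> {c. (r, c) \<in> S}" using assms by auto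
  then have "row_degree S r = card ({..<3} \<inter> {c. (r, c) \<in> S})"
    by (simp only: row_degree_def)
  also have "\<dots> = (\<Sum>c<3. of_bool ((r, c) \<in> S))" by simp
  finally show ?thesis unfolding sum_lessThan_3 .
qed

lemma col_degree_converse: "col_degree (S\<inverse>) = row_degree S"
  by (rule ext) (simp add: col_degree_def row_degree_def)

lemma row_degree_converse: "row_degree (S\<inverse>) = col_degree S"
  by (rule ext) (simp add: col_degree_def row_degree_def)

lemma card_converse: "card (S\<inverse>) = card S"
  by (metis card_inverse)

lemma card_eq_sum_row_degree:
  assumes "finite S" "\<And>r c. (r, c) \<in> S \<Longrightarrow> r \<in> R" "finite R"
  shows "card S = (\<Sum>r\<in>R. row_degree S r)"
  using card_eq_sum_col_degree[of "S\<inverse>" R] assms by (simp add: col_degree_converse card_converse)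

lemma col_degree_grid:
  assumes "S \<subseteq> {..<3} \<times> {..<3}"
  shows "col_degree S c = of_bool ((0, c) \<in> S) + of_bool ((1, c) \<in> S) + of_bool ((2, c) \<in> S)"
proof -
  have "S\<inverse> \<subseteq> {..<3} \<times> {..<3}" using assms by auto
  from row_degree_grid[OF this, of c] show ?thesis by (simp only: row_degree_converse converse_iff)
qed

lemma card_grid:
  assumes "S \<subseteq> {..<3} \<times> {..<3}"
  shows "card S = row_degree S 0 + row_degree S 1 + row_degree S 2"
proof -
  have "finite S" using assms finite_subset by blast
  then have "card S = (\<Sum>r<3. row_degree S r)" using assms by (intro card_eq_sum_row_degree) auto
  then show ?thesis unfolding sum_lessThan_3 .
qed

lemma all_less_3: "(\<forall>i<3. A i) \<longleftrightarrow> A 0 \<and> A 1 \<and> A (2::nat)"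
  by (auto simp: numeral_3_eq_3 less_Suc_eq numeral_2_eq_2)

text \<open>Here \<open>n\<close> lists the row lengths of the core, and corners are measured from
  its first box. If no positive number is left outside the first \<open>j\<close>, then
  \<open>P\<close> is the whole core. Otherwise \<open>mu 0 = 3\<close> and \<open>mu j = 1\<close>,
  which leaves a handful of shapes; in each of them a few boxes \<open>Q\<close> are removed so that
  all degrees of \<open>P\<close> become \<open>j - 1\<close> or \<open>j\<close>.\<close>

lemma core_split:
  fixes n mu :: "nat \<Rightarrow> nat"
  assumes n: "n 0 \<le> 3" "n 1 \<le> n 0" "n 2 \<le> n 1"
    and mu: "mu 1 \<le> mu 0" "mu 2 \<le> mu 1" "mu 3 \<le> mu 2"
    and total: "mu 0 + mu 1 + mu 2 + mu 3 = n 0 + n 1 + n 2"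
    and cut: "\<And>k x y. k \<le> 4 \<Longrightarrow> x \<le> 3 \<Longrightarrow>
      (\<Sum>i<k. mu i) \<le> k * (x + y) + (\<Sum>r\<in>{x..<3}. n r - y)"
    and j: "1 \<le> j" "j \<le> 4" "\<And>i. i < j \<Longrightarrow> mu 0 \<le> mu i + 1" "j < 4 \<Longrightarrow> mu j + 2 \<le> mu 0"
  shows "\<exists>P Q. P \<union> Q = {(r, c). r < 3 \<and> c < n r} \<and> P \<inter> Q = {} \<and>
    card P = (\<Sum>i<j. mu i) \<and>
    (\<forall>i<3. row_degree P i \<le> j \<and> row_degree Q i \<le> 4 - j \<and> col_degree P i \<le> j \<and> col_degree Q i \<le> 4 - j) \<and>
    (Q = {} \<and> (j < 4 \<longrightarrow> 2 \<le> mu 0 \<and> j \<le> card P) \<or>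
     3 \<le> mu 0 \<and> card Q \<le> 4 - j \<and> 2 * j \<le> card P \<and>
       (\<forall>i<3. j \<le> row_degree P i + 1 \<and> j \<le> col_degree P i + 1))"
proof -
  define G where "G = {(r, c). r < 3 \<and> c < n r}"
  have iv: "{0..<3} = {0, 1, 2::nat}" "{1..<3} = {1, 2::nat}" "{2..<3} = {2::nat}" by auto
  have s1: "(\<Sum>i<1. mu i) = mu 0" "(\<Sum>i<2. mu i) = mu 0 + mu 1" "(\<Sum>i<3. mu i) = mu 0 + mu 1 + mu 2"
    "(\<Sum>i<4. mu i) = mu 0 + mu 1 + mu 2 + mu 3"
    by (simp_all add: numeral_eq_Suc)
  \<comment> \<open>These cuts for \<open>k = 1\<close>, with two more for \<open>k = 2\<close>,
    narrow down the shape of the core.\<close>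
  have c1: "mu 0 \<le> 3" "mu 0 \<le> 2 + n 2" "mu 0 \<le> 2 + ((n 0 - 2) + (n 1 - 2) + (n 2 - 2))"
      "mu 0 \<le> 2 + ((n 1 - 1) + (n 2 - 1))"
    using cut[of 1 3 0] cut[of 1 2 0] cut[of 1 0 2] cut[of 1 1 1]
    by (simp_all add: iv s1 del: One_nat_def)
  have c2: "mu 0 + mu 1 \<le> 4 + n 2" "mu 0 + mu 1 \<le> 4 + ((n 0 - 2) + (n 1 - 2) + (n 2 - 2))"
    using cut[of 2 2 0] cut[of 2 0 2] by (simp_all add: iv s1 del: One_nat_def)
  have G3: "G \<subseteq> {..<3} \<times> {..<3}"
  proof -
    have "n r \<le> 3" if "r < 3" for r
    proof -
      have "r = 0 \<or> r = 1 \<or> r = 2" using that by auto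
      then show ?thesis using n by auto
    qed
    then show ?thesis by (fastforce simp: G_def)
  qed
  have j4: "j = 1 \<or> j = 2 \<or> j = 3 \<or> j = 4" using j(1,2) by auto
  show ?thesis
  proof (cases "j = 4 \<or> mu j = 0")
    case True
    then have "(\<Sum>i<j. mu i) = mu 0 + mu 1 + mu 2 + mu 3"
      using j4 mu by (elim disjE) (simp_all add: s1 del: One_nat_def)
    then have sum: "(\<Sum>i<j. mu i) = n 0 + n 1 + n 2" using total by simp
    have of_bool_le: "of_bool (0 < m) + of_bool (1 < m) + of_bool (2 < m) = m" if "m \<le> 3" for m :: nat
      using that by auto
    have row: "row_degree G i = n i" if "i < 3" for i
      unfolding row_degree_grid[OF G3] using that of_bool_le[of "n i"] n
      by (auto simp: G_def numeral_3_eq_3 less_Suc_eq numeral_2_eq_2)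
    \<comment> \<open>The cut below the first row of the core bounds the length of this row by
      \<open>j\<close>. In the same way the cut after the first column bounds the number of nonempty
      rows, and hence all column degrees.\<close>
    have n0: "n 0 \<le> j" using cut[of j 1 0] j(2) sum by (simp add: iv del: One_nat_def)
    have col: "col_degree G c \<le> j" for c
    proof -
      have "col_degree G c \<le> of_bool (0 < n 0) + of_bool (0 < n 1) + of_bool (0 < n 2)"
        unfolding col_degree_grid[OF G3] by (intro add_mono) (auto simp: G_def)
      also have "\<dots> \<le> j"
      proof -
        have split: "n i = (n i - 1) + of_bool (0 < n i)" for i by simp
        have "n 0 + (n 1 + n 2) \<le> j + ((n 0 - 1) + ((n 1 - 1) + (n 2 - 1)))"
          using cut[of j 0 1] j(2) sum by (simp add: iv del: One_nat_def)
        then show ?thesis using split[of 0] split[of 1] split[of 2] by linarith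
      qed
      finally show ?thesis .
    qed
    have cG: "card G = (\<Sum>i<j. mu i)"
      using sum row[of 0] row[of 1] row[of 2] by (simp add: card_grid[OF G3] del: One_nat_def)
    have large: "j < 4 \<longrightarrow> 2 \<le> mu 0 \<and> j \<le> card G"
    proof
      assume "j < 4"
      then have m0: "2 \<le> mu 0" using j(4) by simp
      have "(\<Sum>i<j. 1) \<le> (\<Sum>i<j. mu i)" using j(3) m0 by (intro sum_mono) fastforce
      then show "2 \<le> mu 0 \<and> j \<le> card G" using m0 cG by simp
    qed
    have empty: "row_degree {} i = 0" "col_degree {} i = 0" for i
      by (simp_all add: row_degree_def col_degree_def)
    have "row_degree G i \<le> j" if "i < 3" for i
    proof -
      have "i = 0 \<or> i = 1 \<or> i = 2" using that by auto
      then show ?thesis using row[OF that] n n0 by auto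
    qed
    then show ?thesis
      unfolding G_def[symmetric] using col cG large empty
      by (intro exI[of _ G] exI[of _ "{}"]) simp
  next
    case False
    then have m: "mu 0 = 3" "mu j = 1" "j < 4" using c1(1) j(2,4) by auto
    \<comment> \<open>Membership in \<open>{j - 1..j}\<close> serves twice: the upper end is the
      degree condition, the lower end the last clause of the second alternative.\<close>
    have wit: ?thesis
      if Q: "Q \<subseteq> G"
        and card: "n 0 + n 1 + n 2 = (\<Sum>i<j. mu i) + card Q" "card Q \<le> 4 - j"
        and row: "\<forall>i<3. of_bool ((i, 0) \<in> G - Q) + of_bool ((i, 1) \<in> G - Q) + of_bool ((i, 2) \<in> G - Q) \<in> {j - 1..j} \<and>
          of_bool ((i, 0) \<in> Q) + of_bool ((i, 1) \<in> Q) + of_bool ((i, 2) \<in> Q) \<le> 4 - j"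
        and col: "\<forall>i<3. of_bool ((0, i) \<in> G - Q) + of_bool ((1, i) \<in> G - Q) + of_bool ((2, i) \<in> G - Q) \<in> {j - 1..j} \<and>
          of_bool ((0, i) \<in> Q) + of_bool ((1, i) \<in> Q) + of_bool ((2, i) \<in> Q) \<le> 4 - j"
      for Q
    proof -
      have S: "Q \<subseteq> {..<3} \<times> {..<3}" "G - Q \<subseteq> {..<3} \<times> {..<3}" using Q G3 by auto
      have r: "row_degree (G - Q) i \<in> {j - 1..j} \<and> row_degree Q i \<le> 4 - j"
        and c: "col_degree (G - Q) i \<in> {j - 1..j} \<and> col_degree Q i \<le> 4 - j" if "i < 3" for i
        unfolding row_degree_grid[OF S(1)] row_degree_grid[OF S(2)]
          col_degree_grid[OF S(1)] col_degree_grid[OF S(2)]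
        using row col that by blast+
      have fin: "finite G" using G3 finite_subset by blast
      have "card G = n 0 + n 1 + n 2"
        using n unfolding card_grid[OF G3] row_degree_grid[OF G3] by (auto simp: G_def of_bool_def)
      then have cP: "card (G - Q) = (\<Sum>i<j. mu i)"
        using card(1) Q fin card_Diff_subset[OF finite_subset[OF Q fin] Q] by simp
      have "(\<Sum>i<j. 2) \<le> (\<Sum>i<j. mu i)" using j(3) m(1) by (intro sum_mono) fastforce
      then have two: "2 * j \<le> card (G - Q)" using cP by simp
      have "j \<le> row_degree (G - Q) i + 1 \<and> j \<le> col_degree (G - Q) i + 1" if "i < 3" for i
        using r[OF that] c[OF that] by auto
      then show ?thesis
        unfolding G_def[symmetric] using Q cP two card(2) m(1) r c
        by (intro exI[of _ "G - Q"] exI[of _ Q]) auto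
    qed
    consider "j = 1" "n 0 = 3" "n 1 = 2" "n 2 = 1"
      | "j = 2" "mu 1 = 2" "mu 3 = 0" "n 0 = 3" "n 1 = 2" "n 2 = 1"
      | "j = 2" "n 0 + n 1 + n 2 = mu 0 + mu 1 + 2" "n 0 = 3" "n 1 = 2" "n 2 = 2"
      | "j = 2" "n 0 + n 1 + n 2 = mu 0 + mu 1 + 2" "n 0 = 3" "n 1 = 3" "n 2 = 1"
      | "j = 2" "n 0 + n 1 + n 2 = mu 0 + mu 1 + 2" "n 0 = 3" "n 1 = 3" "n 2 = 2"
      | "j = 3" "n 0 = 3" "n 1 = 3" "n 2 = 2"
      | "j = 3" "n 0 = 3" "n 1 = 3" "n 2 = 3"
    proof -
      have "j = 1 \<or> j = 2 \<or> j = 3" using m(3) j(1) by auto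
      then show ?thesis
      proof (elim disjE)
        assume "j = 1"
        then have "n 0 = 3 \<and> n 1 = 2 \<and> n 2 = 1" using m mu n total c1 by auto
        then show ?thesis using that(1) \<open>j = 1\<close> by blast
      next
        assume "j = 2"
        have mu2: "mu 2 = 1" using m(2) \<open>j = 2\<close> by simp
        have "2 \<le> mu 1" using j(3)[of 1] m \<open>j = 2\<close> by simp
        \<comment> \<open>The possible sequences are 3, 2, 1, 0 with one core shape, 3, 2, 1, 1 with
          two and 3, 3, 1, 1 with one; \<open>c2\<close> rules out 3, 3, 1, 0.\<close>
        then have "mu 1 = 2 \<or> mu 1 = 3" "mu 3 = 0 \<or> mu 3 = 1" using mu mu2 m(1) by auto
        moreover have n0: "n 0 = 3" using c1(3) n m(1) by auto
        moreover have "n 1 = 2 \<and> n 2 = 1" if "mu 1 = 2" "mu 3 = 0"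
          using that total n c1 m mu2 n0 by auto
        moreover have "n 1 = 2 \<and> n 2 = 2 \<or> n 1 = 3 \<and> n 2 = 1" if "mu 1 = 2" "mu 3 = 1"
          using that total n c1 m mu2 n0 by auto
        moreover have "\<not> (mu 1 = 3 \<and> mu 3 = 0)"
          using total n c2 m mu2 n0 by auto
        moreover have "n 1 = 3 \<and> n 2 = 2" if "mu 1 = 3" "mu 3 = 1"
          using that total n c2 m mu2 n0 by auto
        ultimately show ?thesis using that(2-5) total mu2 \<open>j = 2\<close> by (elim disjE) auto
      next
        assume "j = 3"
        have "2 \<le> mu 1" "2 \<le> mu 2" using j(3)[of 1] j(3)[of 2] m \<open>j = 3\<close> by auto
        then have "n 0 = 3 \<and> n 1 = 3 \<and> (n 2 = 2 \<or> n 2 = 3)" using m mu n total c1 \<open>j = 3\<close> by auto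
        then show ?thesis using that(6,7) \<open>j = 3\<close> by blast
      qed
    qed
    then show ?thesis
    proof cases
      case 1
      \<comment> \<open>Removing these three boxes leaves the antidiagonal, where all degrees are
        1.\<close>
      show ?thesis
        by (rule wit[of "{(0, 0), (0, 1), (1, 0)}"])
          (use 1 m in \<open>simp_all add: G_def all_less_3 s1 del: One_nat_def\<close>)
    next
      case 2
      show ?thesis
        by (rule wit[of "{(0, 0)}"]) (use 2 m in \<open>simp_all add: G_def all_less_3 s1 del: One_nat_def\<close>)
    next
      case 3
      show ?thesis
        by (rule wit[of "{(0, 0), (1, 1)}"])
          (use 3 m in \<open>simp_all add: G_def all_less_3 s1 del: One_nat_def\<close>)
    next
      case 4
      show ?thesis
        by (rule wit[of "{(0, 0), (1, 1)}"])
          (use 4 m in \<open>simp_all add: G_def all_less_3 s1 del: One_nat_def\<close>)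
    next
      case 5
      show ?thesis
        by (rule wit[of "{(0, 0), (1, 1)}"])
          (use 5 m in \<open>simp_all add: G_def all_less_3 s1 del: One_nat_def\<close>)
    next
      case 6
      show ?thesis
        by (rule wit[of "{(0, 0)}"])
          (use 6 m total in \<open>simp_all add: G_def all_less_3 s1 del: One_nat_def\<close>)
    next
      case 7
      show ?thesis
        by (rule wit[of "{(0, 0)}"])
          (use 7 m total in \<open>simp_all add: G_def all_less_3 s1 del: One_nat_def\<close>)
    qed
  qed
qed

section \<open>Transposition, translation and the cut bound\<close>

lemma quadrant_converse: "quadrant (Y\<inverse>) x y = (quadrant Y y x)\<inverse>"
  by (auto simp: quadrant_def)

definition shift :: "nat \<Rightarrow> nat \<Rightarrow> (nat \<times> nat) set \<Rightarrow> (nat \<times> nat) set" where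
  "shift a b S = {(r, c). a \<le> r \<and> b \<le> c \<and> (r - a, c - b) \<in> S}"

lemma shift_eq_image: "shift a b S = (\<lambda>(r, c). (r + a, c + b)) ` S"
proof -
  have "(r, c) \<in> (\<lambda>(r, c). (r + a, c + b)) ` S" if "a \<le> r" "b \<le> c" "(r - a, c - b) \<in> S" for r c
    using that by (intro image_eqI[of _ _ "(r - a, c - b)"]) auto
  then show ?thesis by (auto simp: shift_def)
qed

lemma card_shift: "card (shift a b S) = card S"
  unfolding shift_eq_image by (rule card_image) (auto simp: inj_on_def)

lemma col_degree_shift: "col_degree (shift a b S) c = (if b \<le> c then col_degree S (c - b) else 0)"
proof (cases "b \<le> c")
  case True
  have "{r. (r, c) \<in> shift a b S} = (\<lambda>r. r + a) ` {r. (r, c - b) \<in> S}"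
    unfolding shift_eq_image using True by (force simp: image_iff)
  then show ?thesis using True unfolding col_degree_def by (simp add: card_image inj_on_def)
qed (simp add: col_degree_def shift_def)

lemma shift_converse: "(shift a b S)\<inverse> = shift b a (S\<inverse>)"
  by (auto simp: shift_def)

lemma row_degree_shift: "row_degree (shift a b S) r = (if a \<le> r then row_degree S (r - a) else 0)"
  using col_degree_shift[of b a "S\<inverse>" r]
  by (simp add: shift_converse[symmetric] col_degree_converse)

context young_set
begin

lemma young_set_converse: "young_set (Y\<inverse>)"
proof
  show "finite (Y\<inverse>)" using fin by simp
  show "(r', c') \<in> Y\<inverse>" if "(r, c) \<in> Y\<inverse>" "r' \<le> r" "c' \<le> c" for r c r' c'
    using that down by auto
qed

lemma row_degree_quadrant:
  "row_degree (quadrant Y x y) r = (if x \<le> r then row_degree Y r - y else 0)"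
proof -
  have "{c. (r, c) \<in> quadrant Y x y} = (if x \<le> r then {y..<row_degree Y r} else {})"
    by (auto simp: quadrant_def mem_iff_row)
  then show ?thesis unfolding row_degree_def[of "quadrant Y x y"] by simp
qed

lemma card_quadrant_Suc: "card (quadrant Y x y) = (row_degree Y x - y) + card (quadrant Y (Suc x) y)"
proof -
  have "quadrant Y x y = (\<lambda>c. (x, c)) ` {y..<row_degree Y x} \<union> quadrant Y (Suc x) y"
    by (auto simp: quadrant_def mem_iff_row dest: le_neq_implies_less)
  moreover have "card ((\<lambda>c. (x, c)) ` {y..<row_degree Y x}) = row_degree Y x - y"
    by (simp add: card_image inj_on_def)
  moreover have "(\<lambda>c. (x, c)) ` {y..<row_degree Y x} \<inter> quadrant Y (Suc x) y = {}"
    by (auto simp: quadrant_def)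
  ultimately show ?thesis using finite_quadrant by (simp add: card_Un_disjoint)
qed

text \<open>Were row \<open>a\<close> longer than \<open>b + 3\<close>, moving the corner below it
  would cost 4 and save at least 4 boxes. The value would not grow while the quadrant shrinks,
  against the choice of \<open>(a, b)\<close>.\<close>

lemma minimal_cut_row:
  assumes opt: "\<And>x y. 4 * (a + b) + card (quadrant Y a b) \<le> 4 * (x + y) + card (quadrant Y x y)"
    and min: "\<And>x y. 4 * (a + b) + card (quadrant Y a b) = 4 * (x + y) + card (quadrant Y x y) \<Longrightarrow>
      card (quadrant Y a b) \<le> card (quadrant Y x y)"
    and "(r, c) \<in> quadrant Y a b"
  shows "c < 3 + b"
proof -
  have "row_degree Y a \<le> 3 + b"
  proof (rule ccontr)
    assume "\<not> ?thesis"
    then show False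
      using opt[of "Suc a" b] min[of "Suc a" b] card_quadrant_Suc[of a b] by simp
  qed
  moreover have "c < row_degree Y r" "a \<le> r" using assms(3) by (auto simp: quadrant_def mem_iff_row)
  ultimately show ?thesis using row_degree_antimono[of a r] by linarith
qed

definition cut_bound :: "nat \<Rightarrow> nat" where
  "cut_bound k = (LEAST n. \<exists>x y. n = k * (x + y) + card (quadrant Y x y))"

lemma cut_bound_le: "cut_bound k \<le> k * (x + y) + card (quadrant Y x y)"
  unfolding cut_bound_def by (rule Least_le) blast

lemma cut_bound_attained: "\<exists>x y. cut_bound k = k * (x + y) + card (quadrant Y x y)"
  unfolding cut_bound_def by (rule LeastI_ex) blast

text \<open>A pointwise minimum of functions affine in \<open>k\<close> is concave: a minimiser for
  \<open>k + 1\<close> is tested at \<open>k\<close> and at \<open>k + 2\<close>.\<close>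

lemma cut_bound_concave: "cut_bound k + cut_bound (k + 2) \<le> 2 * cut_bound (k + 1)"
proof -
  obtain x y where "cut_bound (k + 1) = (k + 1) * (x + y) + card (quadrant Y x y)"
    using cut_bound_attained by blast
  then show ?thesis
    using cut_bound_le[of k x y] cut_bound_le[of "k + 2" x y] by (simp add: algebra_simps)
qed

lemma cut_bound_0: "cut_bound 0 = 0"
proof -
  have "quadrant Y 0 (row_degree Y 0) = {}"
  proof -
    have "\<not> (c < row_degree Y r \<and> row_degree Y 0 \<le> c)" for r c
      using row_degree_antimono[of 0 r] by linarith
    then show ?thesis by (auto simp: quadrant_def mem_iff_row)
  qed
  then show ?thesis using cut_bound_le[of 0 0 "row_degree Y 0"] by simp
qed

text \<open>The degrees do not add up, since the two arms have no row and no column in common.\<close>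

lemma max_degree_le_union:
  assumes A: "A \<subseteq> Y" "\<And>r c. (r, c) \<in> A \<Longrightarrow> r < a \<and> b \<le> c" "\<And>r. r < a \<Longrightarrow> row_degree A r = k"
      "\<And>c. col_degree A c + col_degree P c \<le> k"
    and B: "B \<subseteq> Y" "\<And>r c. (r, c) \<in> B \<Longrightarrow> a \<le> r \<and> c < b" "\<And>c. c < b \<Longrightarrow> col_degree B c = k"
      "\<And>r. row_degree B r + row_degree P r \<le> k"
    and P: "P \<subseteq> quadrant Y a b"
  shows "max_degree_le (A \<union> B \<union> P) k" "card (A \<union> B \<union> P) = k * (a + b) + card P"
proof -
  have finA: "finite A" and finB: "finite B" and finP: "finite P"
    using A(1) B(1) P fin finite_quadrant finite_subset by blast+
  have disj: "A \<inter> B = {}" "(A \<union> B) \<inter> P = {}"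
    using A(2) B(2) P by (fastforce simp: quadrant_def)+
  have cardA: "card A = k * a"
    using card_eq_sum_row_degree[of A "{..<a}"] finA A(2,3) by auto
  have cardB: "card B = k * b"
    using card_eq_sum_col_degree[of B "{..<b}"] finB B(2,3) by auto
  have "card (A \<union> B \<union> P) = card A + card B + card P"
    using finA finB finP disj by (simp add: card_Un_disjoint)
  then show "card (A \<union> B \<union> P) = k * (a + b) + card P"
    using cardA cardB by (simp add: add_mult_distrib2)
  have col: "col_degree (A \<union> B \<union> P) c \<le> k" for c
  proof -
    have sum: "col_degree (A \<union> B \<union> P) c = col_degree A c + col_degree B c + col_degree P c"
      using finA finB finP disj by (simp add: col_degree_Un)
    show ?thesis
    proof (cases "c < b")
      case True
      then have "{r. (r, c) \<in> A} = {}" "{r. (r, c) \<in> P} = {}"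
        using A(2) P by (force simp: quadrant_def)+
      then have "col_degree A c = 0" "col_degree P c = 0"
        by (simp_all only: col_degree_def card.empty)
      then show ?thesis using sum B(3)[OF True] by simp
    next
      case False
      then have "{r. (r, c) \<in> B} = {}" using B(2) by force
      then have "col_degree B c = 0" by (simp only: col_degree_def card.empty)
      then show ?thesis using sum A(4)[of c] by simp
    qed
  qed
  have row: "row_degree (A \<union> B \<union> P) r \<le> k" for r
  proof -
    have "A\<inverse> \<inter> B\<inverse> = {}" "(A\<inverse> \<union> B\<inverse>) \<inter> P\<inverse> = {}" using disj by auto
    then have sum: "row_degree (A \<union> B \<union> P) r = row_degree A r + row_degree B r + row_degree P r"
      using finA finB finP unfolding col_degree_converse[symmetric] converse_Un
      by (simp add: col_degree_Un)
    show ?thesis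
    proof (cases "r < a")
      case True
      then have "{c. (r, c) \<in> B} = {}" "{c. (r, c) \<in> P} = {}"
        using B(2) P by (force simp: quadrant_def)+
      then have "row_degree B r = 0" "row_degree P r = 0"
        by (simp_all only: row_degree_def card.empty)
      then show ?thesis using sum A(3)[OF True] by simp
    next
      case False
      then have "{c. (r, c) \<in> A} = {}" using A(2) by force
      then have "row_degree A r = 0" by (simp only: row_degree_def card.empty)
      then show ?thesis using sum B(4)[of r] by simp
    qed
  qed
  have "{e\<in>S. fst e = r} = (\<lambda>c. (r, c)) ` {c. (r, c) \<in> S}"
    "{e\<in>S. snd e = c} = (\<lambda>r. (r, c)) ` {r. (r, c) \<in> S}" for S :: "(nat \<times> nat) set" and r c
    by force+
  then have "card {e\<in>S. fst e = r} = row_degree S r" "card {e\<in>S. snd e = c} = col_degree S c"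
    for S :: "(nat \<times> nat) set" and r c
    unfolding row_degree_def col_degree_def by (simp_all add: card_image inj_on_def)
  then show "max_degree_le (A \<union> B \<union> P) k" unfolding max_degree_le_def using row col by presburger
qed

lemma ex_disjoint_matchings:
  "\<exists>M. (\<forall>i<4. matching (M i) \<and> M i \<subseteq> Y \<and> card (M i) = cut_bound (Suc i) - cut_bound i) \<and>
    disjoint_family_on M {..<4}"
proof -
  define opt where "opt = (\<lambda>(x, y). cut_bound 4 = 4 * (x + y) + card (quadrant Y x y))"
  obtain a b where opt: "opt (a, b)"
    and min: "\<And>x y. opt (x, y) \<Longrightarrow> card (quadrant Y a b) \<le> card (quadrant Y x y)"
  proof -
    have "\<exists>e. opt e" using cut_bound_attained[of 4] by (auto simp: opt_def)
    then obtain e where "opt e" "\<And>e'. opt e' \<Longrightarrow> card (quadrant Y (fst e) (snd e)) \<le> card (quadrant Y (fst e') (snd e'))"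
      using ex_has_least_nat[of opt _ "\<lambda>e. card (quadrant Y (fst e) (snd e))"] by blast
    then show ?thesis using that[of "fst e" "snd e"] by fastforce
  qed
  have F4: "cut_bound 4 = 4 * (a + b) + card (quadrant Y a b)" using opt by (simp add: opt_def)
  have cut4: "4 * (a + b) + card (quadrant Y a b) \<le> 4 * (x + y) + card (quadrant Y x y)" for x y
    using cut_bound_le[of 4 x y] F4 by simp
  have min': "card (quadrant Y a b) \<le> card (quadrant Y x y)"
    if "4 * (a + b) + card (quadrant Y a b) = 4 * (x + y) + card (quadrant Y x y)" for x y
    using min[of x y] that F4 by (simp add: opt_def)
  have small_c: "c < 3 + b" if "(r, c) \<in> quadrant Y a b" for r c
    by (rule minimal_cut_row[OF cut4 min' that])
  have small_r: "r < 3 + a" if "(r, c) \<in> quadrant Y a b" for r c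
  proof (rule young_set.minimal_cut_row[OF young_set_converse])
    show "4 * (b + a) + card (quadrant (Y\<inverse>) b a) \<le> 4 * (x + y) + card (quadrant (Y\<inverse>) x y)" for x y
      using cut4[of y x] by (simp add: quadrant_converse card_converse add.commute)
    show "card (quadrant (Y\<inverse>) b a) \<le> card (quadrant (Y\<inverse>) x y)"
      if "4 * (b + a) + card (quadrant (Y\<inverse>) b a) = 4 * (x + y) + card (quadrant (Y\<inverse>) x y)" for x y
      using min'[of y x] that by (simp add: quadrant_converse card_converse add.commute)
    show "(c, r) \<in> quadrant (Y\<inverse>) b a" using that by (simp add: quadrant_converse)
  qed
  define n where "n i = row_degree Y (i + a) - b" for i
  have quad: "card (quadrant Y (x + a) (y + b)) = (\<Sum>r\<in>{x..<3}. n r - y)" for x y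
  proof -
    have "card (quadrant Y (x + a) (y + b)) = (\<Sum>r\<in>{x + a..<3 + a}. row_degree (quadrant Y (x + a) (y + b)) r)"
      using small_r by (intro card_eq_sum_row_degree finite_quadrant) (fastforce simp: quadrant_def)+
    also have "\<dots> = (\<Sum>r\<in>{x..<3}. row_degree (quadrant Y (x + a) (y + b)) (r + a))"
      by (rule sum.shift_bounds_nat_ivl)
    also have "\<dots> = (\<Sum>r\<in>{x..<3}. n r - y)"
      by (intro sum.cong) (auto simp: row_degree_quadrant n_def)
    finally show ?thesis .
  qed
  define F where "F = cut_bound"
  \<comment> \<open>The subtraction does not truncate for \<open>k < 4\<close>: testing the corner
    \<open>(a, b)\<close> for 3 gives \<open>F 4 - F 3 \<ge> a + b\<close>, and by concavity the
    earlier differences are at least as large.\<close>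
  define mu where "mu k = F (Suc k) - F k - (a + b)" for k
  have F3: "F 3 \<le> 3 * (a + b) + card (quadrant Y a b)" unfolding F_def by (rule cut_bound_le)
  have conc: "F 0 + F 2 \<le> 2 * F 1" "F 1 + F 3 \<le> 2 * F 2" "F 2 + F 4 \<le> 2 * F 3"
    using cut_bound_concave[of 0] cut_bound_concave[of 1] cut_bound_concave[of 2]
    unfolding F_def by (simp_all add: numeral_eq_Suc)
  have F4': "F 4 = 4 * (a + b) + card (quadrant Y a b)" using F4 by (simp add: F_def)
  have Suc: "Suc 0 = 1" "Suc 1 = 2" "Suc 2 = 3" "Suc 3 = 4" by auto
  have steps: "F 1 = F 0 + (a + b) + mu 0" "F 2 = F 1 + (a + b) + mu 1"
    "F 3 = F 2 + (a + b) + mu 2" "F 4 = F 3 + (a + b) + mu 3"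
  proof -
    have "F 3 + (a + b) \<le> F 4" using F3 F4' by simp
    moreover from this have "F 2 + (a + b) \<le> F 3" using conc(3) by linarith
    moreover from this have "F 1 + (a + b) \<le> F 2" using conc(2) by linarith
    moreover from this have "F 0 + (a + b) \<le> F 1" using conc(1) by linarith
    ultimately show "F 1 = F 0 + (a + b) + mu 0" "F 2 = F 1 + (a + b) + mu 1"
      "F 3 = F 2 + (a + b) + mu 2" "F 4 = F 3 + (a + b) + mu 3"
      unfolding mu_def Suc by linarith+
  qed
  have step: "F (Suc k) = F k + (a + b) + mu k" if "k < 4" for k
  proof -
    have "k = 0 \<or> k = 1 \<or> k = 2 \<or> k = 3" using that by auto
    then show ?thesis using steps by (elim disjE) (simp_all add: numeral_eq_Suc)
  qed
  have F_sum: "F k = k * (a + b) + (\<Sum>i<k. mu i)" if "k \<le> 4" for k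
    using that
  proof (induction k)
    case 0
    then show ?case by (simp add: F_def cut_bound_0)
  next
    case (Suc k)
    then show ?case using step[of k] by simp
  qed
  have mu_anti: "mu 1 \<le> mu 0" "mu 2 \<le> mu 1" "mu 3 \<le> mu 2" using conc steps by linarith+
  have mu_le: "mu i' \<le> mu i" if "i \<le> i'" "i' < 4" for i i'
  proof -
    have "i = 0 \<or> i = 1 \<or> i = 2 \<or> i = 3" "i' = 0 \<or> i' = 1 \<or> i' = 2 \<or> i' = 3" using that by auto
    then show ?thesis using mu_anti that(1) by (elim disjE) auto
  qed
  have n: "n 0 \<le> 3" "n 1 \<le> n 0" "n 2 \<le> n 1"
  proof -
    show "n 0 \<le> 3"
    proof (rule ccontr)
      assume "\<not> ?thesis"
      then have "(a, b + 3) \<in> quadrant Y a b" by (auto simp: n_def quadrant_def mem_iff_row)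
      then show False using small_c by force
    qed
    show "n 1 \<le> n 0" "n 2 \<le> n 1"
      unfolding n_def by (intro diff_le_mono row_degree_antimono; simp)+
  qed
  have total: "mu 0 + mu 1 + mu 2 + mu 3 = n 0 + n 1 + n 2"
    using quad[of 0 0] F4' steps cut_bound_0 by (simp add: F_def numeral_eq_Suc)
  have cut: "(\<Sum>i<k. mu i) \<le> k * (x + y) + (\<Sum>r\<in>{x..<3}. n r - y)" if "k \<le> 4" for k x y
    using cut_bound_le[of k "x + a" "y + b"] F_sum[OF that] quad[of x y]
    by (simp add: F_def algebra_simps)
  \<comment> \<open>As \<open>mu\<close> decreases, the first \<open>j\<close> numbers are exactly
    those at least \<open>mu 0 - 1\<close>; \<open>j = 4\<close> if this holds for all of
    them.\<close>
  define j where "j = (LEAST j. j = 4 \<or> mu j + 2 \<le> mu 0)"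
  have j: "j = 4 \<or> mu j + 2 \<le> mu 0" unfolding j_def by (rule LeastI[of _ 4]) simp
  have j4: "j \<le> 4" unfolding j_def by (rule Least_le) simp
  have top: "mu 0 \<le> mu i + 1" if "i < j" for i
    using not_less_Least[of i "\<lambda>j. j = 4 \<or> mu j + 2 \<le> mu 0"] that unfolding j_def by simp
  have j1: "1 \<le> j" using j by (cases j) auto
  define l where "l = 4 - j"
  have jl: "j + l = 4" using j4 by (simp add: l_def)
  have jm: "mu j + 2 \<le> mu 0" if "j < 4" using that j by simp
  have "\<exists>P0 Q0. P0 \<union> Q0 = {(r, c). r < 3 \<and> c < n r} \<and> P0 \<inter> Q0 = {} \<and> card P0 = (\<Sum>i<j. mu i) \<and>
    (\<forall>i<3. row_degree P0 i \<le> j \<and> row_degree Q0 i \<le> 4 - j \<and>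
      col_degree P0 i \<le> j \<and> col_degree Q0 i \<le> 4 - j) \<and>
    (Q0 = {} \<and> (j < 4 \<longrightarrow> 2 \<le> mu 0 \<and> j \<le> card P0) \<or>
     3 \<le> mu 0 \<and> card Q0 \<le> 4 - j \<and> 2 * j \<le> card P0 \<and>
       (\<forall>i<3. j \<le> row_degree P0 i + 1 \<and> j \<le> col_degree P0 i + 1))"
    by (rule core_split[OF n mu_anti total _ j1 j4]) (rule cut top jm; assumption)+
  then obtain P0 Q0 where PQ0: "P0 \<union> Q0 = {(r, c). r < 3 \<and> c < n r}" "P0 \<inter> Q0 = {}"
      "card P0 = (\<Sum>i<j. mu i)"
    and deg0: "\<forall>i<3. row_degree P0 i \<le> j \<and> row_degree Q0 i \<le> 4 - j \<and>
      col_degree P0 i \<le> j \<and> col_degree Q0 i \<le> 4 - j"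
    and split0: "Q0 = {} \<and> (j < 4 \<longrightarrow> 2 \<le> mu 0 \<and> j \<le> card P0) \<or>
     3 \<le> mu 0 \<and> card Q0 \<le> 4 - j \<and> 2 * j \<le> card P0 \<and>
       (\<forall>i<3. j \<le> row_degree P0 i + 1 \<and> j \<le> col_degree P0 i + 1)"
    by (elim exE conjE) (rule that)
  have l4: "4 - j = l" "j < 4 \<longleftrightarrow> 0 < l" using jl by (auto simp: l_def)
  note deg0 = deg0[unfolded l4] and split0 = split0[unfolded l4]
  define P where "P = shift a b P0"
  define Q where "Q = shift a b Q0"
  have nu: "P \<union> Q = quadrant Y a b"
  proof -
    have "P \<union> Q = shift a b (P0 \<union> Q0)" by (auto simp: P_def Q_def shift_def)
    also have "\<dots> = quadrant Y a b"
    proof -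
      have "(r, c) \<in> shift a b (P0 \<union> Q0) \<longleftrightarrow> (r, c) \<in> quadrant Y a b" for r c
        using small_r[of r c] by (auto simp: PQ0(1) shift_def quadrant_def mem_iff_row n_def)
      then show ?thesis by auto
    qed
    finally show ?thesis .
  qed
  have disj: "P \<inter> Q = {}" using PQ0(2) by (auto simp: P_def Q_def shift_def)
  have cardP: "card P = (\<Sum>i<j. mu i)" and cardQ: "card Q = card Q0"
    using PQ0(3) by (simp_all add: P_def Q_def card_shift)
  have PQsub: "P \<subseteq> quadrant Y a b" "Q \<subseteq> quadrant Y a b" using nu by auto
  have finPQ: "finite P" "finite Q" using PQsub finite_quadrant finite_subset by blast+
  have sub0: "P0 \<subseteq> {..<3} \<times> {..<3}" "Q0 \<subseteq> {..<3} \<times> {..<3}"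
  proof -
    have "r < 3 \<and> c < 3" if "(r, c) \<in> P0 \<union> Q0" for r c
    proof -
      have "(r + a, c + b) \<in> P \<union> Q" using that by (auto simp: P_def Q_def shift_def)
      then have "(r + a, c + b) \<in> quadrant Y a b" unfolding nu .
      then show ?thesis using small_r small_c by fastforce
    qed
    then show "P0 \<subseteq> {..<3} \<times> {..<3}" "Q0 \<subseteq> {..<3} \<times> {..<3}" by auto
  qed
  have degP: "row_degree P i \<le> j" "col_degree P i \<le> j"
    and degQ: "row_degree Q i \<le> l" "col_degree Q i \<le> l" for i
  proof -
    have zero: "row_degree S i = 0" "col_degree S i = 0"
      if "S \<subseteq> {..<3} \<times> {..<3}" "\<not> i < 3" for S i
      using that unfolding row_degree_grid[OF that(1)] col_degree_grid[OF that(1)] by auto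
    have all: "row_degree P0 i \<le> j \<and> row_degree Q0 i \<le> l \<and> col_degree P0 i \<le> j \<and> col_degree Q0 i \<le> l" for i
    proof (cases "i < 3")
      case True
      then show ?thesis using deg0 by blast
    qed (simp add: zero[OF sub0(1)] zero[OF sub0(2)])
    show "row_degree P i \<le> j" "col_degree P i \<le> j" "row_degree Q i \<le> l" "col_degree Q i \<le> l"
      using all by (auto simp: P_def Q_def row_degree_shift col_degree_shift)
  qed
  have split: "Q = {} \<and> (0 < l \<longrightarrow> 2 \<le> mu 0 \<and> j \<le> card P) \<or>
    3 \<le> mu 0 \<and> card Q \<le> l \<and> 2 * j \<le> card P \<and>
      (\<forall>i<3. j \<le> row_degree P (i + a) + 1 \<and> j \<le> col_degree P (i + b) + 1)"
  proof -
    have "row_degree P (i + a) = row_degree P0 i" "col_degree P (i + b) = col_degree P0 i" for i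
      by (simp_all add: P_def row_degree_shift col_degree_shift)
    moreover have "Q = {}" if "Q0 = {}" using that by (simp add: Q_def shift_def)
    moreover have "card P = card P0" using cardP PQ0(3) by simp
    ultimately show ?thesis using split0 cardQ by (elim disjE) simp_all
  qed
  have cutj: "j * (a + b) + card P \<le> j * (x + y) + card (quadrant Y x y)" for x y
    using cut_bound_le[of j x y] F_sum[OF j4] cardP by (simp add: F_def)
  have cut1: "a + b + mu 0 \<le> x + y + card (quadrant Y x y)" for x y
    using cut_bound_le[of 1 x y] F_sum[of 1] by (simp add: F_def)
  have "\<exists>J K. J \<subseteq> Y \<and> K \<subseteq> Y \<and> J \<inter> K = {} \<and>
    (\<forall>(r, c) \<in> J \<union> K. r < a \<and> b \<le> c) \<and> (\<forall>r<a. row_degree J r = j \<and> row_degree K r = l) \<and>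
    (\<forall>c. col_degree J c + col_degree P c \<le> j \<and> col_degree K c + col_degree Q c \<le> l)"
  proof (rule arm_filling[OF nu disj _ jl, where m = "mu 0"])
    show "c < 3 + b" if "(r, c) \<in> quadrant Y a b" for r c by (rule small_c[OF that])
    show "Q = {} \<and> (0 < l \<longrightarrow> 2 \<le> mu 0 \<and> j \<le> card P) \<or>
      3 \<le> mu 0 \<and> card Q \<le> l \<and> 2 * j \<le> card P \<and> (\<forall>i<3. j \<le> col_degree P (i + b) + 1)"
      using split by blast
  qed (rule cut4 cutj cut1 degP degQ)+
  then obtain JA KA where A: "JA \<subseteq> Y" "KA \<subseteq> Y" "JA \<inter> KA = {}"
    "\<forall>(r, c) \<in> JA \<union> KA. r < a \<and> b \<le> c" "\<forall>r<a. row_degree JA r = j \<and> row_degree KA r = l"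
    "\<forall>c. col_degree JA c + col_degree P c \<le> j \<and> col_degree KA c + col_degree Q c \<le> l"
    by (elim exE conjE) (rule that)
  \<comment> \<open>The other arm is the first arm of \<open>Y\<inverse>\<close>, with
    \<open>a\<close> and \<open>b\<close> exchanged.\<close>
  have "\<exists>J K. J \<subseteq> Y\<inverse> \<and> K \<subseteq> Y\<inverse> \<and> J \<inter> K = {} \<and>
    (\<forall>(r, c) \<in> J \<union> K. r < b \<and> a \<le> c) \<and> (\<forall>r<b. row_degree J r = j \<and> row_degree K r = l) \<and>
    (\<forall>c. col_degree J c + col_degree (P\<inverse>) c \<le> j \<and> col_degree K c + col_degree (Q\<inverse>) c \<le> l)"
  proof (rule young_set.arm_filling[OF young_set_converse, where m = "mu 0"])
    show "P\<inverse> \<union> Q\<inverse> = quadrant (Y\<inverse>) b a" using nu by (auto simp: quadrant_converse)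
    show "P\<inverse> \<inter> Q\<inverse> = {}" using disj by auto
    show "c < 3 + a" if "(r, c) \<in> quadrant (Y\<inverse>) b a" for r c
      using that small_r by (simp add: quadrant_converse)
    show "j + l = 4" by (rule jl)
    show "4 * (b + a) + card (quadrant (Y\<inverse>) b a) \<le> 4 * (x + y) + card (quadrant (Y\<inverse>) x y)" for x y
      using cut4[of y x] by (simp add: quadrant_converse card_converse add.commute)
    show "j * (b + a) + card (P\<inverse>) \<le> j * (x + y) + card (quadrant (Y\<inverse>) x y)" for x y
      using cutj[of y x] by (simp add: quadrant_converse card_converse add.commute)
    show "b + a + mu 0 \<le> x + y + card (quadrant (Y\<inverse>) x y)" for x y
      using cut1[of y x] by (simp add: quadrant_converse card_converse add.commute)
    show "col_degree (P\<inverse>) c \<le> j" "col_degree (Q\<inverse>) c \<le> l" for c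
      using degP degQ by (simp_all add: col_degree_converse)
    show "Q\<inverse> = {} \<and> (0 < l \<longrightarrow> 2 \<le> mu 0 \<and> j \<le> card (P\<inverse>)) \<or>
      3 \<le> mu 0 \<and> card (Q\<inverse>) \<le> l \<and> 2 * j \<le> card (P\<inverse>) \<and> (\<forall>i<3. j \<le> col_degree (P\<inverse>) (i + a) + 1)"
      using split by (auto simp: card_converse col_degree_converse)
  qed
  then obtain JB' KB' where B': "JB' \<subseteq> Y\<inverse>" "KB' \<subseteq> Y\<inverse>" "JB' \<inter> KB' = {}"
    "\<forall>(c, r) \<in> JB' \<union> KB'. c < b \<and> a \<le> r"
    "\<forall>c<b. row_degree JB' c = j \<and> row_degree KB' c = l"
    "\<forall>r. col_degree JB' r + col_degree (P\<inverse>) r \<le> j \<and> col_degree KB' r + col_degree (Q\<inverse>) r \<le> l"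
    by (elim exE conjE) (rule that)
  define JB where "JB = JB'\<inverse>"
  define KB where "KB = KB'\<inverse>"
  have B: "JB \<subseteq> Y" "KB \<subseteq> Y" "JB \<inter> KB = {}" "\<forall>(r, c) \<in> JB \<union> KB. a \<le> r \<and> c < b"
    "\<forall>c<b. col_degree JB c = j \<and> col_degree KB c = l"
    "\<forall>r. row_degree JB r + row_degree P r \<le> j \<and> row_degree KB r + row_degree Q r \<le> l"
    using B' unfolding JB_def KB_def by (auto simp: col_degree_converse row_degree_converse)
  define HJ where "HJ = JA \<union> JB \<union> P"
  define HK where "HK = KA \<union> KB \<union> Q"
  have memA: "r < a \<and> b \<le> c" if "(r, c) \<in> JA \<union> KA" for r c using A(4) that by blast
  have memB: "a \<le> r \<and> c < b" if "(r, c) \<in> JB \<union> KB" for r c using B(4) that by blast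
  have HJ: "max_degree_le HJ j" "card HJ = j * (a + b) + card P"
    unfolding HJ_def
    by (rule max_degree_le_union[where a = a and b = b]; use A(1,5,6) B(1,5,6) memA memB PQsub in blast)+
  have HK: "max_degree_le HK l" "card HK = l * (a + b) + card Q"
    unfolding HK_def
    by (rule max_degree_le_union[where a = a and b = b]; use A(2,5,6) B(2,5,6) memA memB PQsub in blast)+
  have subY: "HJ \<subseteq> Y" "HK \<subseteq> Y"
    using A B PQsub unfolding HJ_def HK_def quadrant_def by auto
  have finH: "finite HJ" "finite HK" using subY fin finite_subset by blast+
  have disjH: "HJ \<inter> HK = {}"
  proof -
    have mem: "a \<le> r \<and> b \<le> c" if "(r, c) \<in> P \<union> Q" for r c
      using that unfolding nu by (simp add: quadrant_def)
    have False if HJK: "(r, c) \<in> HJ" "(r, c) \<in> HK" for r c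
    proof -
      consider "r < a" | "a \<le> r" "c < b" | "a \<le> r" "b \<le> c" by linarith
      then show False
      proof cases
        case 1
        then have "(r, c) \<notin> JB \<union> KB" "(r, c) \<notin> P \<union> Q" using memB[of r c] mem[of r c] by auto
        then show False using HJK A(3) unfolding HJ_def HK_def by blast
      next
        case 2
        then have "(r, c) \<notin> JA \<union> KA" "(r, c) \<notin> P \<union> Q" using memA[of r c] mem[of r c] by auto
        then show False using HJK B(3) unfolding HJ_def HK_def by blast
      next
        case 3
        then have "(r, c) \<notin> JA \<union> KA" "(r, c) \<notin> JB \<union> KB" using memA[of r c] memB[of r c] by auto
        then show False using HJK disj unfolding HJ_def HK_def by blast
      qed
    qed
    then show ?thesis by auto
  qed
  obtain MJ where MJ: "proper_edge_coloring j MJ" "(\<Union>i<j. MJ i) = HJ" "\<forall>i<j. card (MJ i) = a + b + mu i"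
  proof -
    have "(\<Sum>i<j. a + b + mu i) = card HJ" using HJ(2) cardP by (simp add: sum.distrib)
    moreover have "a + b + mu i \<le> a + b + mu i' + 1" if "i < j" "i' < j" for i i'
      using top[OF that(2)] mu_le[of 0 i] that(1) j4 by simp
    ultimately show ?thesis
      using equitable_edge_coloring[OF finH(1) HJ(1), of "\<lambda>i. a + b + mu i"] that by blast
  qed
  have sumQ: "(\<Sum>i<l. mu (j + i)) = card Q"
  proof -
    have "card P + card Q = card (quadrant Y a b)"
      using nu disj finPQ by (metis card_Un_disjoint)
    also have "\<dots> = (\<Sum>i<4. mu i)" using F_sum[of 4] F4' by simp
    also have "\<dots> = (\<Sum>i<j. mu i) + (\<Sum>i\<in>{0 + j..<l + j}. mu i)"
      using sum.atLeastLessThan_concat[of 0 j 4 mu] j4 jl by (simp add: atLeast0LessThan add.commute)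
    also have "(\<Sum>i\<in>{0 + j..<l + j}. mu i) = (\<Sum>i<l. mu (j + i))"
      unfolding sum.shift_bounds_nat_ivl by (simp add: atLeast0LessThan add.commute)
    finally show ?thesis using cardP by simp
  qed
  obtain MK where MK: "proper_edge_coloring l MK" "(\<Union>i<l. MK i) = HK"
    "\<forall>i<l. card (MK i) = a + b + mu (j + i)"
  proof -
    have "(\<Sum>i<l. a + b + mu (j + i)) = card HK" using HK(2) sumQ by (simp add: sum.distrib)
    moreover have "a + b + mu (j + i) \<le> a + b + mu (j + i') + 1" if "i < l" "i' < l" for i i'
    proof -
      \<comment> \<open>The cut below all three rows of the core bounds \<open>mu 0\<close> by 3. As
        \<open>mu j\<close> is smaller by at least 2, the second group takes only the values 0 and
        1.\<close>
      have "mu 0 \<le> 3" using cut[of 1 3 0] by simp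
      then have "mu j \<le> 1" using j jl that by auto
      then show ?thesis using mu_le[of j "j + i"] that(1) jl by simp
    qed
    ultimately show ?thesis
      using equitable_edge_coloring[OF finH(2) HK(1), of "\<lambda>i. a + b + mu (j + i)"] that by blast
  qed
  define M where "M i = (if i < j then MJ i else MK (i - j))" for i
  have M_sub: "M i \<subseteq> (if i < j then HJ else HK)" if "i < 4" for i
    using MJ(2) MK(2) that jl by (auto simp: M_def)
  show ?thesis
  proof (intro exI conjI allI impI)
    fix i :: nat assume i: "i < 4"
    show "matching (M i)"
      using MJ(1) MK(1) i jl by (auto simp: M_def proper_edge_coloring_def)
    show "M i \<subseteq> Y" using M_sub[OF i] subY by (auto split: if_splits)
    have "card (M i) = a + b + mu i"
      using MJ(3) MK(3) i jl by (auto simp: M_def)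
    then show "card (M i) = cut_bound (Suc i) - cut_bound i" using step[OF i] by (simp add: F_def)
  next
    show "disjoint_family_on M {..<4}"
      unfolding disjoint_family_on_def
    proof (intro ballI impI)
      fix i i' :: nat assume i: "i \<in> {..<4}" "i' \<in> {..<4}" "i \<noteq> i'"
      consider "i < j" "i' < j" | "\<not> i < j" "\<not> i' < j" | "i < j \<longleftrightarrow> \<not> i' < j" by blast
      then show "M i \<inter> M i' = {}"
      proof cases
        case 1
        then show ?thesis
          using MJ(1) i by (simp add: M_def proper_edge_coloring_def disjoint_family_on_def)
      next
        case 2
        then have "i - j < l" "i' - j < l" "i - j \<noteq> i' - j" using i jl by auto
        then show ?thesis
          using MK(1) 2 by (simp add: M_def proper_edge_coloring_def disjoint_family_on_def)
      next
        case 3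
        then show ?thesis using M_sub[of i] M_sub[of i'] i disjH by (auto split: if_splits)
      qed
    qed
  qed
qed

end

section \<open>Colorings of the partition graph\<close>

lemma young_set_young_diagram:
  assumes "is_partition lam"
  shows "young_set (young_diagram lam)"
proof
  show "finite (young_diagram lam)" by (rule finite_young_diagram)
  fix r c r' c' assume rc: "(r, c) \<in> young_diagram lam" "r' \<le> r" "c' \<le> c"
  have "lam ! r \<le> lam ! r'"
  proof (cases "r' = r")
    case False
    then show ?thesis
      using assms rc sorted_wrt_nth_less[of "(\<ge>)" lam r' r]
      by (auto simp: is_partition_def young_diagram_def)
  qed simp
  then show "(r', c') \<in> young_diagram lam" using rc by (auto simp: young_diagram_def)
qed

lemma stable_set_partition_graph:
  "stable_set (partition_graph lam) S \<longleftrightarrow> S \<subseteq> young_diagram lam \<and> matching S"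
  unfolding stable_set_def partition_graph_def matching_def inj_on_def
  by (auto 4 4)

text \<open>A box outside the quadrant lies in one of \<open>x\<close> rows or in one of
  \<open>y\<close> columns, and a matching has at most one box in each of them.\<close>

lemma card_matching_le:
  assumes "finite M" "matching M" "M \<subseteq> Y"
  shows "card (M - quadrant Y x y) \<le> x + y"
proof -
  define A where "A = {e\<in>M. fst e < x}"
  define B where "B = {e\<in>M. snd e < y}"
  have "card A = card (fst ` A)" "card B = card (snd ` B)"
    using assms(2) by (auto simp: A_def B_def matching_def card_image inj_on_def)
  moreover have "card (fst ` A) \<le> card {..<x}" "card (snd ` B) \<le> card {..<y}"
    by (intro card_mono; auto simp: A_def B_def)+
  moreover have "card (M - quadrant Y x y) \<le> card (A \<union> B)"
    using assms(1,3) by (intro card_mono) (auto simp: A_def B_def quadrant_def)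
  ultimately show ?thesis using card_Un_le[of A B] by simp
qed

text \<open>The quadrant is counted once for all matchings together; outside it each of them
  contributes at most \<open>x + y\<close>.\<close>

lemma (in young_set) card_union_matchings_le:
  assumes "\<And>i. i < k \<Longrightarrow> M i \<subseteq> Y \<and> matching (M i)"
  shows "card (\<Union>i<k. M i) \<le> cut_bound k"
proof -
  obtain x y where xy: "cut_bound k = k * (x + y) + card (quadrant Y x y)"
    using cut_bound_attained by blast
  have finM: "finite (M i)" if "i < k" for i using assms[OF that] fin finite_subset by blast
  have "card (\<Union>i<k. M i) \<le> card ((\<Union>i<k. M i - quadrant Y x y) \<union> quadrant Y x y)"
    using finM finite_quadrant by (intro card_mono) auto
  also have "\<dots> \<le> card (\<Union>i<k. M i - quadrant Y x y) + card (quadrant Y x y)"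
    by (rule card_Un_le)
  also have "card (\<Union>i<k. M i - quadrant Y x y) \<le> (\<Sum>i<k. card (M i - quadrant Y x y))"
    by (rule card_UN_le) simp
  also have "\<dots> \<le> (\<Sum>i<k. x + y)"
    using assms finM by (intro sum_mono card_matching_le) auto
  finally show ?thesis using xy by simp
qed

definition disjoint_stable_families :: "'a pair_pre_digraph \<Rightarrow> nat \<Rightarrow> (nat \<Rightarrow> 'a set) set" where
  "disjoint_stable_families G k =
    {S. (\<forall>j<k. stable_set G (S j)) \<and> disjoint_family_on S {..<k}}"

lemma max_stable_union_eq:
  assumes fin: "finite (pverts G)"
    and S: "S \<in> disjoint_stable_families G k"
    and max: "\<And>T. T \<in> disjoint_stable_families G k \<Longrightarrow> card (\<Union>j<k. T j) \<le> card (\<Union>j<k. S j)"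
  shows "max_stable_union G k = card (\<Union>j<k. S j)"
proof -
  have eq: "max_stable_union G k = Max {card (\<Union>j<k. S j) |S. S \<in> disjoint_stable_families G k}"
    by (simp add: max_stable_union_def disjoint_stable_families_def)
  show ?thesis
    unfolding eq
  proof (rule Max_eqI)
    show "finite {card (\<Union>j<k. S j) |S. S \<in> disjoint_stable_families G k}"
      by (rule finite_subset[of _ "{..card (\<Union>j<k. S j)}"]) (use max in auto)
    show "n \<le> card (\<Union>j<k. S j)" if "n \<in> {card (\<Union>j<k. S j) |S. S \<in> disjoint_stable_families G k}" for n
      using that max by auto
    show "card (\<Union>j<k. S j) \<in> {card (\<Union>j<k. S j) |S. S \<in> disjoint_stable_families G k}"
      using S by blast
  qed
qed

text \<open>The sizes telescope, since \<open>cut_bound\<close> is monotone and the differences do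
  not truncate.\<close>

lemma (in young_set) card_union_matchings_eq:
  assumes M: "\<And>i. i < k \<Longrightarrow> M i \<subseteq> Y \<and> card (M i) = cut_bound (Suc i) - cut_bound i"
    and disj: "disjoint_family_on M {..<k}"
  shows "card (\<Union>i<k. M i) = cut_bound k"
proof -
  have mono: "cut_bound i \<le> cut_bound (Suc i)" for i
  proof -
    obtain x y where "cut_bound (Suc i) = Suc i * (x + y) + card (quadrant Y x y)"
      using cut_bound_attained by blast
    then show ?thesis using cut_bound_le[of i x y] by simp
  qed
  have tele: "(\<Sum>i<m. cut_bound (Suc i) - cut_bound i) = cut_bound m" for m
  proof (induction m)
    case (Suc m)
    then show ?case using mono[of m] by simp
  qed (simp add: cut_bound_0)
  have finM: "finite (M i)" if "i < k" for i using M[OF that] fin finite_subset by blast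
  have "card (\<Union>i<k. M i) = (\<Sum>i<k. card (M i))"
    using finM disj by (intro card_UN_disjoint') auto
  also have "\<dots> = (\<Sum>i<k. cut_bound (Suc i) - cut_bound i)"
    using M by (intro sum.cong) auto
  finally show ?thesis using tele by simp
qed

lemma rev_sorted_list_of_multiset:
  assumes "sorted_wrt (\<ge>) L"
  shows "rev (sorted_list_of_multiset (mset L)) = (L :: nat list)"
proof -
  have "sorted (rev L)" using assms by (simp add: sorted_wrt_rev)
  then have "sort L = rev L" by (intro properties_for_sort) simp_all
  then show ?thesis by (simp add: sorted_list_of_multiset_mset)
qed

theorem theorem3:
  fixes lam :: "nat list"
  assumes "is_partition lam"
  shows "\<exists>\<kappa>. coloring (partition_graph lam) \<kappa> \<and>
    (\<forall>i\<in>{1..4}. nth_default 0 (shape (partition_graph lam) \<kappa>) (i - 1) = cds (partition_graph lam) i)"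
proof -
  define Y where "Y = young_diagram lam"
  interpret young_set Y unfolding Y_def by (rule young_set_young_diagram[OF assms])
  \<comment> \<open>Numbered from 0: for \<open>i < 4\<close>, \<open>\<delta> i\<close> will be
    term \<open>i + 1\<close> of the chromatic difference sequence.\<close>
  define \<delta> where "\<delta> i = cut_bound (Suc i) - cut_bound i" for i
  obtain M where M: "\<And>i. i < 4 \<Longrightarrow> matching (M i) \<and> M i \<subseteq> Y" "\<And>i. i < 4 \<Longrightarrow> card (M i) = \<delta> i"
    and disj: "disjoint_family_on M {..<4}"
    using ex_disjoint_matchings unfolding \<delta>_def by blast
  have finM: "finite (M i)" if "i < 4" for i using M(1)[OF that] fin finite_subset by blast
  have cardU: "card (\<Union>i<k. M i) = cut_bound k" if "k \<le> 4" for k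
  proof (rule card_union_matchings_eq)
    show "disjoint_family_on M {..<k}"
      by (rule disjoint_family_on_mono[OF _ disj]) (use that in auto)
  qed (use M that in \<open>auto simp: \<delta>_def\<close>)
  \<comment> \<open>The first \<open>k\<close> matchings attain the upper bound for unions of
    \<open>k\<close> stable sets, for all \<open>k \<le> 4\<close> simultaneously.\<close>
  have opt: "max_stable_union (partition_graph lam) k = cut_bound k" if "k \<le> 4" for k
    unfolding cardU[OF that, symmetric]
  proof (rule max_stable_union_eq)
    show "finite (pverts (partition_graph lam))" using fin by (simp add: partition_graph_def Y_def)
    have "disjoint_family_on M {..<k}"
      by (rule disjoint_family_on_mono[OF _ disj]) (use that in auto)
    then show "M \<in> disjoint_stable_families (partition_graph lam) k"
      using M(1) that by (simp add: disjoint_stable_families_def stable_set_partition_graph Y_def)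
    show "card (\<Union>i<k. T i) \<le> card (\<Union>i<k. M i)"
      if "T \<in> disjoint_stable_families (partition_graph lam) k" for T
      unfolding cardU[OF \<open>k \<le> 4\<close>] using that
      by (intro card_union_matchings_le)
        (simp add: disjoint_stable_families_def stable_set_partition_graph Y_def)
  qed
  have cds: "cds (partition_graph lam) (Suc i) = \<delta> i" if "i < 4" for i
    using opt[of "Suc i"] opt[of i] that by (simp add: cds_def \<delta>_def)
  have \<delta>_anti: "\<delta> (Suc i) \<le> \<delta> i" for i
    using cut_bound_concave[of i] unfolding \<delta>_def by simp
  define R where "R = Y - (\<Union>i<4. M i)"
  have finR: "finite R" using fin by (simp add: R_def)
  \<comment> \<open>If \<open>\<delta> k = 0\<close>, a leftover box added to the first
    \<open>k\<close> matchings as a matching of its own would exceed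
    \<open>cut_bound (Suc k)\<close>. So singleton classes occur only when all four sizes are
    positive, and can be listed after them.\<close>
  have pos: "0 < \<delta> k" if k: "k < 4" and ne: "R \<noteq> {}" for k
  proof (rule ccontr)
    assume "\<not> 0 < \<delta> k"
    then have "cut_bound (Suc k) \<le> cut_bound k" by (simp add: \<delta>_def)
    obtain e where e: "e \<in> Y" "e \<notin> (\<Union>i<4. M i)" using ne by (auto simp: R_def)
    define N where "N = M(k := {e})"
    have "card (\<Union>i<Suc k. N i) \<le> cut_bound (Suc k)"
      using M(1) k e(1) by (intro card_union_matchings_le) (auto simp: N_def matching_def)
    moreover have "(\<Union>i<Suc k. N i) = insert e (\<Union>i<k. M i)"
      by (auto simp: N_def less_Suc_eq)
    moreover have "e \<notin> (\<Union>i<k. M i)" using e k by auto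
    moreover have "finite (\<Union>i<k. M i)" using finM k by auto
    moreover have "card (\<Union>i<k. M i) = cut_bound k" using cardU[of k] k by simp
    ultimately show False using \<open>cut_bound (Suc k) \<le> cut_bound k\<close> by simp
  qed
  obtain f :: "nat \<times> nat \<Rightarrow> nat" where f: "inj_on f Y"
    using finite_imp_inj_to_nat_seg[OF fin] by blast
  \<comment> \<open>Colours 0 to 3 stand for the four matchings; the offset 4 keeps the leftover
    boxes apart from them.\<close>
  define \<kappa> where "\<kappa> e = (if e \<in> R then 4 + f e else (LEAST i. e \<in> M i))" for e
  have \<kappa>_M: "\<kappa> e = i" if "i < 4" "e \<in> M i" for e i
  proof -
    have "e \<notin> R" using that by (auto simp: R_def)
    moreover have "(LEAST i. e \<in> M i) = i"
    proof (rule Least_equality)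
      fix i' assume i': "e \<in> M i'"
      show "i \<le> i'"
      proof (rule ccontr)
        assume "\<not> i \<le> i'"
        then have "M i \<inter> M i' = {}"
          using disj that(1) unfolding disjoint_family_on_def by auto
        then show False using that(2) i' by auto
      qed
    qed (rule that(2))
    ultimately show ?thesis by (simp add: \<kappa>_def)
  qed
  have \<kappa>_R: "\<kappa> e = 4 + f e" if "e \<in> R" for e using that by (simp add: \<kappa>_def)
  have inj_R: "inj_on \<kappa> R"
    using f by (auto simp: inj_on_def \<kappa>_R R_def)
  define G where "G = partition_graph lam"
  have verts: "pverts G = Y" by (simp add: G_def Y_def partition_graph_def)
  have class_M: "color_class G \<kappa> i = M i" if i: "i < 4" for i
  proof -
    have "e \<in> M i" if e: "e \<in> Y" "\<kappa> e = i" for e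
    proof -
      have "e \<notin> R" using \<kappa>_R[of e] e(2) i by auto
      then obtain i' where "i' < 4" "e \<in> M i'" using e by (auto simp: R_def)
      then show ?thesis using \<kappa>_M e by auto
    qed
    then show ?thesis using \<kappa>_M[OF i] M(1)[OF i] by (auto simp: color_class_def verts)
  qed
  have class_R: "color_class G \<kappa> (\<kappa> e) = {e}" if e: "e \<in> R" for e
  proof -
    have "e' = e" if e': "e' \<in> Y" "\<kappa> e' = \<kappa> e" for e'
    proof (cases "e' \<in> R")
      case True
      then show ?thesis using inj_R e that by (auto simp: inj_on_def)
    next
      case False
      then obtain i where "i < 4" "e' \<in> M i" using e' by (auto simp: R_def)
      then show ?thesis using \<kappa>_M[of i e'] \<kappa>_R[OF e] e' by simp
    qed
    then show ?thesis using e by (auto simp: color_class_def verts R_def)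
  qed
  have "coloring G \<kappa>"
  proof -
    have "\<kappa> u \<noteq> \<kappa> v" if uv: "(u, v) \<in> parcs G" for u v
    proof
      assume eq: "\<kappa> u = \<kappa> v"
      have uv': "u \<in> Y" "v \<in> Y" "u \<noteq> v" "fst u = fst v \<or> snd u = snd v"
        using uv by (auto simp: G_def partition_graph_def Y_def)
      then have mem: "u \<in> color_class G \<kappa> (\<kappa> u)" "v \<in> color_class G \<kappa> (\<kappa> u)"
        using eq by (auto simp: color_class_def verts)
      show False
      proof (cases "u \<in> R")
        case True
        then show ?thesis using class_R mem uv'(3) by auto
      next
        case False
        then obtain i where i: "i < 4" "u \<in> M i" using uv' by (auto simp: R_def)
        then have "v \<in> M i" using mem class_M \<kappa>_M by auto
        then show ?thesis using M(1)[OF i(1)] i(2) uv'(3,4) by (auto simp: matching_def inj_on_def)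
      qed
    qed
    then show ?thesis by (auto simp: coloring_def)
  qed
  \<comment> \<open>Empty matchings contribute no colour, as \<open>shape\<close> lists nonempty
    classes only; the missing terms reappear as the default 0 of \<open>nth_default\<close>.\<close>
  define A where "A = {i\<in>{..<4}. 0 < \<delta> i}"
  define L where "L = filter ((<) 0) (map \<delta> [0..<4]) @ replicate (card R) 1"
  have image: "\<kappa> ` Y = A \<union> \<kappa> ` R"
  proof -
    have "Y = (\<Union>i<4. M i) \<union> R" using M(1) by (auto simp: R_def)
    moreover have "\<kappa> ` (\<Union>i<4. M i) = A"
    proof -
      have "i \<in> A" if "i < 4" "e \<in> M i" for i e
      proof -
        have "0 < card (M i)" using that finM[OF that(1)] by (auto simp: card_gt_0_iff)
        then show ?thesis using that(1) M(2)[OF that(1)] by (simp add: A_def)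
      qed
      moreover have "i \<in> \<kappa> ` (\<Union>i<4. M i)" if "i \<in> A" for i
      proof -
        have i: "i < 4" "M i \<noteq> {}" using that M(2)[of i] by (auto simp: A_def)
        then obtain e where "e \<in> M i" by blast
        then show ?thesis using i(1) \<kappa>_M[of i e] by (intro image_eqI[of _ _ e]) auto
      qed
      ultimately show ?thesis using \<kappa>_M by auto
    qed
    ultimately show ?thesis by (metis image_Un)
  qed
  have "A \<inter> \<kappa> ` R = {}" by (auto simp: A_def \<kappa>_R simp del: split_paired_All)
  then have "mset_set (\<kappa> ` Y) = mset_set A + mset_set (\<kappa> ` R)"
    unfolding image using finR by (intro mset_set_Union) (auto simp: A_def)
  then have "{# card (color_class G \<kappa> c). c \<in># mset_set (\<kappa> ` Y) #}
    = {# card (color_class G \<kappa> c). c \<in># mset_set A #} + {# card (color_class G \<kappa> c). c \<in># mset_set (\<kappa> ` R) #}"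
    by simp
  also have "{# card (color_class G \<kappa> c). c \<in># mset_set A #} = image_mset \<delta> (mset_set A)"
    using class_M M(2) by (intro image_mset_cong) (auto simp: A_def)
  also have "mset_set A = mset (filter (\<lambda>i. 0 < \<delta> i) [0..<4])"
    unfolding A_def by (subst mset_set_set[symmetric]) (auto intro: arg_cong[of _ _ mset_set])
  also have "{# card (color_class G \<kappa> c). c \<in># mset_set (\<kappa> ` R) #} = {# 1. c \<in># mset_set (\<kappa> ` R) #}"
    using class_R finR by (intro image_mset_cong) auto
  also have "\<dots> = replicate_mset (card R) 1"
    using card_image[OF inj_R] by (simp add: image_mset_const_eq)
  also have "image_mset \<delta> (mset (filter (\<lambda>i. 0 < \<delta> i) [0..<4])) + replicate_mset (card R) 1 = mset L"
    by (simp only: L_def mset_append mset_replicate filter_map mset_map comp_def)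
  finally have shape: "shape G \<kappa> = rev (sorted_list_of_multiset (mset L))"
    by (simp add: shape_def verts)
  have upt4: "[0..<4] = [0, 1, 2, 3::nat]" by (simp add: upt_rec)
  have anti: "\<delta> 1 \<le> \<delta> 0" "\<delta> 2 \<le> \<delta> 1" "\<delta> 3 \<le> \<delta> 2"
    using \<delta>_anti[of 0] \<delta>_anti[of 1] \<delta>_anti[of 2] by (simp_all add: numeral_eq_Suc)
  have L: "sorted_wrt (\<ge>) L" "\<And>i. i < 4 \<Longrightarrow> nth_default 0 L i = \<delta> i"
  proof -
    have "sorted_wrt (\<ge>) L \<and> (\<forall>i<4. nth_default 0 L i = \<delta> i)"
    proof (cases "R = {}")
      case True
      \<comment> \<open>As \<open>\<delta>\<close> decreases, the filter only drops zeros at the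
        end.\<close>
      then have "L = filter ((<) 0) [\<delta> 0, \<delta> 1, \<delta> 2, \<delta> 3]" by (simp add: L_def upt4)
      then show ?thesis
        using anti by (auto simp: numeral_eq_Suc less_Suc_eq nth_default_Cons)
    next
      case False
      then have "0 < \<delta> 0" "0 < \<delta> 1" "0 < \<delta> 2" "0 < \<delta> 3" using pos by auto
      then have L4: "L = [\<delta> 0, \<delta> 1, \<delta> 2, \<delta> 3] @ replicate (card R) 1" by (simp add: L_def upt4)
      moreover have "sorted_wrt (\<ge>) (replicate (card R) (1::nat))"
        by (simp add: sorted_wrt_iff_nth_less)
      moreover have "nth_default 0 L i = \<delta> i" if "i < 4" for i
        using that by (auto simp: L4 nth_default_append numeral_eq_Suc less_Suc_eq nth_default_Cons)
      ultimately show ?thesis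
        using anti \<open>0 < \<delta> 3\<close> by (auto simp: sorted_wrt_append)
    qed
    then show "sorted_wrt (\<ge>) L" "\<And>i. i < 4 \<Longrightarrow> nth_default 0 L i = \<delta> i" by auto
  qed
  have "shape G \<kappa> = L" unfolding shape by (rule rev_sorted_list_of_multiset[OF L(1)])
  then have "nth_default 0 (shape G \<kappa>) (i - 1) = cds G i" if "i \<in> {1..4}" for i
  proof -
    have "i - 1 < 4" "Suc (i - 1) = i" using that by auto
    with \<open>shape G \<kappa> = L\<close> show ?thesis using L(2)[of "i - 1"] cds[of "i - 1"] by (simp add: G_def)
  qed
  then show ?thesis using \<open>coloring G \<kappa>\<close> unfolding G_def by blast
qed

end
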